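(* For all integers $k\ge 1$ and $n\ge 3$, $$(n-1)k+n+1\le GR_k(C_{2n})\le (n-1)k+2n+2.$$
   Context: A Gallai coloring of a complete graph is an edge-coloring with no rainbow triangle (a triangle whose three edges receive three distinct colors); a Gallai $k$-coloring is a Gallai coloring using $k$ colors. For a graph $H$ and integer $k\ge1$, the Gallai-Ramsey number $GR_k(H)$ is the least positive integer $N$ such that every Gallai $k$-coloring of the complete graph $K_N$ contains a monochromatic copy of $H$. $C_m$ denotes the cycle on $m$ vertices. *)

theory Defs
  imports "HOL-Library.Ramsey"
begin

text \<open>
  A graph is a pair of a vertex set and a set of edges, the edges being 2-element sets of vertices.
  The complete graph on \<open>V\<close> has edge set \<open>[V]\<^bsup>2\<^esup>\<close>.
\<close>

type_synonym 'a graph = "'a set \<times> 'a set set"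

definition verts :: "'a graph \<Rightarrow> 'a set" where
  "verts G = fst G"

definition edges :: "'a graph \<Rightarrow> 'a set set" where
  "edges G = snd G"

definition finite_simple_graph :: "'a graph \<Rightarrow> bool" where
  "finite_simple_graph G \<longleftrightarrow> finite (verts G) \<and> edges G \<subseteq> [verts G]\<^bsup>2\<^esup>"

definition complete_graph :: "nat \<Rightarrow> nat graph" where
  "complete_graph N = ({..<N}, [{..<N}]\<^bsup>2\<^esup>)"

text \<open>Meaningful for \<open>m \<ge> 3\<close> only.\<close>

definition cycle_graph :: "nat \<Rightarrow> nat graph" where
  "cycle_graph m = ({..<m}, {{i, Suc i mod m} | i. i < m})"

definition rainbow_triangle :: "'a graph \<Rightarrow> ('a set \<Rightarrow> nat) \<Rightarrow> 'a \<Rightarrow> 'a \<Rightarrow> 'a \<Rightarrow> bool" where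
  "rainbow_triangle G c x y z \<longleftrightarrow>
     {x, y} \<in> edges G \<and> {y, z} \<in> edges G \<and> {x, z} \<in> edges G \<and>
     c {x, y} \<noteq> c {y, z} \<and> c {y, z} \<noteq> c {x, z} \<and> c {x, y} \<noteq> c {x, z}"

text \<open>
  The colors are \<open>0, \<dots>, k - 1\<close>, and not all of them have to occur. Requiring all of them to occur
  would make the Gallai-Ramsey number degenerate: for \<open>k \<ge> 2\<close>, the graph \<open>K\<^sub>1\<close> has no such
  coloring at all.
\<close>

definition gallai_coloring :: "nat \<Rightarrow> 'a graph \<Rightarrow> ('a set \<Rightarrow> nat) \<Rightarrow> bool" where
  "gallai_coloring k G c \<longleftrightarrow>
     c \<in> edges G \<rightarrow> {..<k} \<and> \<not> (\<exists>x y z. rainbow_triangle G c x y z)"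

text \<open>Copies are subgraphs, not necessarily induced.\<close>

definition has_mono_copy :: "'b graph \<Rightarrow> nat \<Rightarrow> 'a graph \<Rightarrow> ('a set \<Rightarrow> nat) \<Rightarrow> bool" where
  "has_mono_copy H k G c \<longleftrightarrow>
     (\<exists>f. \<exists>i<k. inj_on f (verts H) \<and> f ` verts H \<subseteq> verts G \<and>
       (\<forall>e\<in>edges H. f ` e \<in> edges G \<and> c (f ` e) = i))"

definition gallai_ramsey_property :: "nat \<Rightarrow> 'b graph \<Rightarrow> nat \<Rightarrow> bool" where
  "gallai_ramsey_property k H N \<longleftrightarrow>
     (\<forall>c. gallai_coloring k (complete_graph N) c \<longrightarrow> has_mono_copy H k (complete_graph N) c)"

definition gallai_ramsey :: "nat \<Rightarrow> 'b graph \<Rightarrow> nat" where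
  "gallai_ramsey k H = (LEAST N. N > 0 \<and> gallai_ramsey_property k H N)"

text \<open>By Ramsey's theorem, the minimum in this definition exists.\<close>

lemma gallai_ramsey_property_exists:
  assumes "k \<ge> 1" and H: "finite_simple_graph H"
  shows "\<exists>N>0. gallai_ramsey_property k H N"
proof -
  let ?m = "card (verts H)"
  obtain N0 :: nat where "partn_lst {..<N0} (replicate k ?m) 2"
    using ramsey_full by blast
  then have N: "partn_lst {..<Suc N0} (replicate k ?m) 2"
    by (rule partn_lst_greater_resource) simp
  have "has_mono_copy H k (complete_graph (Suc N0)) c"
    if "gallai_coloring k (complete_graph (Suc N0)) c" for c
  proof -
    have "c \<in> [{..<Suc N0}]\<^bsup>2\<^esup> \<rightarrow> {..<k}"
      using that by (simp add: gallai_coloring_def complete_graph_def edges_def)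
    then obtain i S where i: "i < k" and S: "S \<in> [{..<Suc N0}]\<^bsup>?m\<^esup>" and mono: "c ` [S]\<^bsup>2\<^esup> \<subseteq> {i}"
      using partn_lstE[OF N, of c k] by (metis length_replicate nth_replicate)
    have S': "S \<subseteq> {..<Suc N0}" "finite S" "card S = ?m"
      using S by (auto simp: nsets_def)
    then obtain f where f: "bij_betw f (verts H) S"
      using H finite_same_card_bij unfolding finite_simple_graph_def by metis
    have "f ` e \<in> [S]\<^bsup>2\<^esup>" if "e \<in> edges H" for e
      using that H bij_betw_nsets[OF f, of 2]
      unfolding finite_simple_graph_def bij_betw_def by blast
    moreover have "[S]\<^bsup>2\<^esup> \<subseteq> [{..<Suc N0}]\<^bsup>2\<^esup>"
      using S'(1) by (rule nsets_mono)
    ultimately have "inj_on f (verts H) \<and> f ` verts H \<subseteq> {..<Suc N0} \<and>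
        (\<forall>e\<in>edges H. f ` e \<in> [{..<Suc N0}]\<^bsup>2\<^esup> \<and> c (f ` e) = i)"
      using f S'(1) mono unfolding bij_betw_def by blast
    then show ?thesis
      using i unfolding has_mono_copy_def complete_graph_def verts_def edges_def
      by (auto intro!: exI[of _ f] exI[of _ i])
  qed
  then show ?thesis
    unfolding gallai_ramsey_property_def by blast
qed

lemma finite_simple_cycle_graph:
  assumes "m \<ge> 3"
  shows "finite_simple_graph (cycle_graph m)"
proof -
  have "{i, Suc i mod m} \<in> [{..<m}]\<^bsup>2\<^esup>" if "i < m" for i
    unfolding doubleton_in_nsets_2 using that assms by (auto simp: mod_Suc)
  then show ?thesis
    by (auto simp only: finite_simple_graph_def cycle_graph_def verts_def edges_def
        fst_conv snd_conv finite_lessThan)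
qed

end

theory Submission
  imports Defs
begin

text \<open>
  Lower bound: order the vertices, let the first \<open>2n - 1\<close> form block \<open>0\<close> and each further \<open>n - 1\<close> the
  next block, and color an edge by the block of its larger vertex. A monochromatic cycle is
  contained in block \<open>0\<close> or covered by a single block of \<open>n - 1\<close> vertices.

  Upper bound: let \<open>A\<close> be a minimal homogeneous set with at least \<open>n\<close> vertices. At most \<open>n - 1\<close>
  outside vertices send a given color to \<open>A\<close>, since \<open>C\<^sub>2\<^sub>n\<close> is contained in \<open>K\<^sub>n\<^sub>,\<^sub>n\<close>. By Gallai's theorem two
  colors, red and blue, suffice to disconnect \<open>A\<close> when they are removed, and \<open>A\<close> together with the outside
  vertices that are red or blue to it has at least \<open>4n\<close> vertices. There the components of the
  other colors have fewer than \<open>n\<close> vertices and are sets of twins for red and blue, so it remains to find a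
  monochromatic \<open>C\<^sub>2\<^sub>n\<close> in such a blow-up of a 2-colored complete graph. One extends \<open>C\<^sub>2\<^sub>l\<close> to
  \<open>C\<^sub>2\<^sub>l\<^sub>+\<^sub>2\<close> for \<open>l < n\<close>, possibly in the other color: if a red \<open>C\<^sub>2\<^sub>l\<close> cannot be extended, then almost
  every outside vertex has at least \<open>l\<close> blue neighbors on it. If \<open>l + 1\<close> of them have at least \<open>l + 1\<close>
  such neighbors, Jackson's theorem on cycles in bipartite graphs gives a blue \<open>C\<^sub>2\<^sub>l\<^sub>+\<^sub>2\<close>; the others
  are joined to the cycle in essentially only one way.
\<close>

section \<open>Cycles\<close>

text \<open>The closing edge runs from the last element to the first. Lists with one or two elements
  can qualify, but only lengths from 4 on matter for the theorem.\<close>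

definition is_cycle :: "('a \<Rightarrow> 'a \<Rightarrow> bool) \<Rightarrow> 'a list \<Rightarrow> bool" where
  "is_cycle R xs \<longleftrightarrow> distinct xs \<and> successively R xs \<and> R (last xs) (hd xs)"

lemma is_cycle_rotate:
  assumes "is_cycle R (as @ bs)" "as \<noteq> []" "bs \<noteq> []"
  shows "is_cycle R (bs @ as)"
  using assms by (auto simp: is_cycle_def successively_append_iff)

lemma is_cycle_insert_edge:
  assumes "is_cycle R xs" "xs \<noteq> []" "u \<noteq> v" "u \<notin> set xs" "v \<notin> set xs"
    and "R (last xs) u" "R u v" "R v (hd xs)"
  shows "is_cycle R (xs @ [u, v])"
  using assms by (auto simp: is_cycle_def successively_append_iff)

lemma is_cycle_insert_two:
  assumes "is_cycle R (as @ bs)" "as \<noteq> []" "bs \<noteq> []" "u \<noteq> v"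
    and "u \<notin> set (as @ bs)" "v \<notin> set (as @ bs)"
    and "R (last as) u" "R u (hd bs)" "R (last bs) v" "R v (hd as)"
  shows "is_cycle R (as @ u # bs @ [v])"
  using assms by (auto simp: is_cycle_def successively_append_iff successively_Cons)

text \<open>Without the two edges between \<open>as\<close> and \<open>bs\<close>, two paths remain.
  Here \<open>u\<close> joins their starts and \<open>v\<close> their ends, so one of them is
  traversed backwards.\<close>

lemma is_cycle_insert_two_twisted:
  assumes "symp R" "is_cycle R (as @ bs)" "as \<noteq> []" "bs \<noteq> []" "u \<noteq> v"
    and "u \<notin> set (as @ bs)" "v \<notin> set (as @ bs)"
    and "R (hd as) u" "R u (hd bs)" "R (last bs) v" "R v (last as)"
  shows "is_cycle R (rev as @ u # bs @ [v])"
proof -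
  have "successively (\<lambda>x y. R y x) as"
    using assms(1,2) by (auto simp: is_cycle_def successively_append_iff symp_def intro: successively_mono)
  then show ?thesis
    using assms(2-) by (auto simp: is_cycle_def successively_append_iff successively_Cons hd_rev last_rev)
qed

text \<open>Makes a chosen edge the closing one, so that inserting into it means appending to the
  list.\<close>

lemma is_cycle_rotate_at:
  assumes "is_cycle R xs" "i < length xs"
  obtains ys where "is_cycle R ys" "set ys = set xs" "length ys = length xs"
    "last ys = xs ! i" "hd ys = xs ! (Suc i mod length xs)" "ys = rotate (Suc i) xs"
proof (cases "Suc i = length xs")
  case True
  then have ne: "xs \<noteq> []" by auto
  have "last xs = xs ! i" using True ne by (metis diff_Suc_1 last_conv_nth)
  then show ?thesis
    using that[of xs] assms True ne by (simp add: hd_conv_nth)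
next
  case False
  let ?ys = "drop (Suc i) xs @ take (Suc i) xs"
  have "is_cycle R (take (Suc i) xs @ drop (Suc i) xs)"
    using assms by simp
  then have "is_cycle R ?ys"
    by (rule is_cycle_rotate) (use assms False in auto)
  moreover have "set ?ys = set xs"
    by (metis append_take_drop_id set_append sup_commute)
  moreover have "length ?ys = length xs" using assms by simp
  moreover have "last ?ys = xs ! i"
    using assms by (simp add: take_Suc_conv_app_nth)
  moreover have "hd ?ys = xs ! (Suc i mod length xs)"
    using assms False by (simp add: hd_drop_conv_nth)
  moreover have "?ys = rotate (Suc i) xs"
    using assms False by (simp add: rotate_drop_take)
  ultimately show ?thesis using that by metis
qed

lemma is_cycle_cut_at:
  assumes "is_cycle R xs" "i < length xs" "j < length xs" "i \<noteq> j"
  obtains as bs where "as \<noteq> []" "bs \<noteq> []" "is_cycle R (as @ bs)" "set (as @ bs) = set xs"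
    "length as + length bs = length xs"
    "last as = xs ! i" "hd bs = xs ! (Suc i mod length xs)"
    "last bs = xs ! j" "hd as = xs ! (Suc j mod length xs)"
proof -
  define L where "L = length xs"
  have main: "\<exists>as bs. as \<noteq> [] \<and> bs \<noteq> [] \<and> is_cycle R (as @ bs) \<and> set (as @ bs) = set xs \<and>
      length as + length bs = length xs \<and> last as = xs ! i \<and> hd bs = xs ! (Suc i mod L) \<and>
      last bs = xs ! j \<and> hd as = xs ! (Suc j mod L)" if ij: "i < j" "j < L" for i j
  proof -
    obtain ys where ys: "is_cycle R ys" "set ys = set xs" "length ys = L"
      "last ys = xs ! i" "hd ys = xs ! (Suc i mod L)" "ys = rotate (Suc i) xs"
      using is_cycle_rotate_at[OF assms(1), of i] ij unfolding L_def by (metis less_trans)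
    \<comment> \<open>After the rotation, position \<open>i + 1\<close> is at the front, so the path
      from there to \<open>j\<close> has \<open>j - i\<close> vertices.\<close>
    define t where "t = j - i"
    have t: "0 < t" "t < L" using ij by (auto simp: t_def)
    let ?bs = "take t ys" and ?as = "drop t ys"
    have ne: "?as \<noteq> []" "?bs \<noteq> []" using t ys(3) by auto
    have c: "is_cycle R (?as @ ?bs)"
      using is_cycle_rotate[of R ?bs ?as] ys(1) ne by simp
    have "last ?as = xs ! i" using ne ys(4) by simp
    moreover have "hd ?bs = xs ! (Suc i mod L)" using ne ys(5) t by (metis hd_take)
    moreover have "last ?bs = xs ! j"
    proof -
      have "last ?bs = ys ! (t - 1)"
        using t ys(3) ne(2) by (simp add: last_conv_nth)
      also have "\<dots> = xs ! ((Suc i + (t - 1)) mod L)"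
        unfolding ys(6) L_def by (rule nth_rotate) (use t in \<open>auto simp: L_def\<close>)
      also have "(Suc i + (t - 1)) mod L = j" using ij t by (simp add: t_def)
      finally show ?thesis .
    qed
    moreover have "hd ?as = xs ! (Suc j mod L)"
    proof -
      have "hd ?as = ys ! t" using t ys(3) by (simp add: hd_drop_conv_nth)
      also have "\<dots> = xs ! ((Suc i + t) mod L)"
        unfolding ys(6) L_def by (rule nth_rotate) (use t in \<open>auto simp: L_def\<close>)
      also have "Suc i + t = Suc j" using ij by (simp add: t_def)
      finally show ?thesis .
    qed
    moreover have "set (?as @ ?bs) = set xs"
      using ys(2) by (metis append_take_drop_id set_append sup_commute)
    moreover have "length ?as + length ?bs = length xs"
      using ys(3) t by (simp add: L_def)
    ultimately show ?thesis using ne c by blast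
  qed
  show ?thesis
  proof (cases "i < j")
    case True
    then obtain as bs where *: "as \<noteq> []" "bs \<noteq> []" "is_cycle R (as @ bs)" "set (as @ bs) = set xs"
      "length as + length bs = length xs" "last as = xs ! i" "hd bs = xs ! (Suc i mod L)"
      "last bs = xs ! j" "hd as = xs ! (Suc j mod L)"
      using main[of i j] assms unfolding L_def by blast
    then show ?thesis by (intro that) (auto simp: L_def)
  next
    case False
    then have "j < i" using assms(4) by simp
    then obtain as bs where *: "as \<noteq> []" "bs \<noteq> []" "is_cycle R (as @ bs)" "set (as @ bs) = set xs"
      "length as + length bs = length xs" "last as = xs ! j" "hd bs = xs ! (Suc j mod L)"
      "last bs = xs ! i" "hd as = xs ! (Suc i mod L)"
      using main[of j i] assms unfolding L_def by blast
    show ?thesis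
    proof (rule that)
      show "bs \<noteq> []" "as \<noteq> []" "is_cycle R (bs @ as)"
        using * is_cycle_rotate[OF *(3) *(1,2)] by blast+
      show "set (bs @ as) = set xs" "length bs + length as = length xs" using *(4,5) by auto
    qed (use * in \<open>auto simp: L_def\<close>)
  qed
qed

lemma is_cycle_nth:
  assumes "is_cycle R xs" "i < length xs"
  shows "R (xs ! i) (xs ! (Suc i mod length xs))"
proof (cases "Suc i = length xs")
  case True
  then have "xs \<noteq> []" "i = length xs - 1" by auto
  then have "xs ! i = last xs" "xs ! (Suc i mod length xs) = hd xs"
    using True by (simp_all add: last_conv_nth hd_conv_nth)
  then show ?thesis using assms(1) by (simp add: is_cycle_def)
next
  case False
  then have "Suc i < length xs" using assms(2) by simp
  then show ?thesis using assms(1) by (simp add: is_cycle_def successively_nth)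
qed

lemma is_cycle_mono:
  assumes "is_cycle R xs" "\<And>x y. R x y \<Longrightarrow> R' x y"
  shows "is_cycle R' xs"
  using assms by (auto simp: is_cycle_def intro: successively_mono)

lemma is_cycle_subset:
  assumes "is_cycle R xs" "\<And>x y. R x y \<Longrightarrow> x \<in> V"
  shows "set xs \<subseteq> V"
  using is_cycle_nth[OF assms(1)] assms(2) by (metis in_set_conv_nth subsetI)

section \<open>Interleaving two lists, and cycles in complete bipartite graphs\<close>

lemma set_splice [simp]: "set (splice xs ys) = set xs \<union> set ys"
  by (induction xs ys rule: splice.induct) auto

lemma distinct_splice:
  "distinct xs \<Longrightarrow> distinct ys \<Longrightarrow> set xs \<inter> set ys = {} \<Longrightarrow> distinct (splice xs ys)"
  by (rule distinct_disjoint_shuffles) auto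

lemma hd_splice: "xs \<noteq> [] \<Longrightarrow> hd (splice xs ys) = hd xs"
  by (cases xs) auto

lemma last_splice:
  assumes "length ys \<le> length xs" "length xs \<le> Suc (length ys)" "xs \<noteq> []"
  shows "last (splice xs ys) = (if length xs = length ys then last ys else last xs)"
  using assms
proof (induction xs ys rule: splice.induct)
  case (2 x xs ys)
  show ?case
  proof (cases "ys = []")
    case True
    then show ?thesis using 2(2,3) by simp
  next
    case False
    have "last (splice ys xs) = (if length ys = length xs then last xs else last ys)"
      using 2(1)[OF _ _ False] 2(2,3) by simp
    moreover have "length ys = length xs \<or> length ys = Suc (length xs)"
      using 2(2,3) by (simp, linarith)
    moreover have "xs \<noteq> []" if "length ys = length xs" using that False by auto
    ultimately show ?thesis using False by (auto simp: last_ConsR split: if_splits)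
  qed
qed simp

lemma successively_splice:
  assumes "length ys \<le> length xs" "length xs \<le> Suc (length ys)"
    and "\<And>x y. x \<in> set xs \<Longrightarrow> y \<in> set ys \<Longrightarrow> R x y \<and> R y x"
  shows "successively R (splice xs ys)"
  using assms
proof (induction xs ys rule: splice.induct)
  case (2 x xs ys)
  have "successively R (splice ys xs)"
    using 2 by auto
  then show ?case
    using 2(2-4) by (cases ys) (auto simp: successively_Cons)
qed auto

lemma obtain_subset_list:
  assumes "m \<le> card A"
  obtains xs where "distinct xs" "set xs \<subseteq> A" "length xs = m"
proof -
  obtain S where "S \<subseteq> A" "card S = m" "finite S"
    using obtain_subset_with_card_n[OF assms] by blast
  moreover obtain xs where "set xs = S" "distinct xs"
    using finite_distinct_list[OF \<open>finite S\<close>] by blast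
  ultimately show ?thesis using that[of xs] by (metis distinct_card)
qed

lemma complete_bipartite_cycle:
  assumes "symp R" "\<And>x y. x \<in> X \<Longrightarrow> y \<in> Y \<Longrightarrow> R x y" "X \<inter> Y = {}"
    and "m \<le> card X" "m \<le> card Y" "0 < m"
  obtains xs where "is_cycle R xs" "length xs = 2 * m"
proof -
  obtain as where as: "distinct as" "set as \<subseteq> X" "length as = m"
    using obtain_subset_list[OF assms(4)] .
  obtain bs where bs: "distinct bs" "set bs \<subseteq> Y" "length bs = m"
    using obtain_subset_list[OF assms(5)] .
  have ne: "as \<noteq> []" "bs \<noteq> []" using as bs assms(6) by auto
  have R: "R x y \<and> R y x" if "x \<in> set as" "y \<in> set bs" for x y
    using assms(1,2) that as bs by (meson subsetD sympD)
  have "is_cycle R (splice as bs)"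
    unfolding is_cycle_def
    using as bs ne R assms(3)
    by (auto simp: hd_splice last_splice intro!: distinct_splice successively_splice)
  then show ?thesis using that as bs by simp
qed

section \<open>Jackson's theorem on cycles in bipartite graphs\<close>

lemma bipartite_cycle_card:
  assumes "is_cycle H xs" "\<And>x y. H x y \<Longrightarrow> (x \<in> A \<and> y \<in> B) \<or> (x \<in> B \<and> y \<in> A)" "A \<inter> B = {}"
  shows "card (set xs \<inter> A) \<le> card (set xs \<inter> B)"
proof -
  define L where "L = length xs"
  have d: "distinct xs" using assms(1) by (simp add: is_cycle_def)
  have ix: "card (set xs \<inter> S) = card {i. i < L \<and> xs ! i \<in> S}" for S
  proof -
    have "set xs \<inter> S = (!) xs ` {i. i < L \<and> xs ! i \<in> S}"
      by (auto simp: L_def in_set_conv_nth)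
    moreover have "inj_on ((!) xs) {i. i < L \<and> xs ! i \<in> S}"
      using d by (auto simp: inj_on_def L_def nth_eq_iff_index_eq)
    ultimately show ?thesis by (simp add: card_image)
  qed
  \<comment> \<open>The successor map on positions is injective and leads from \<open>A\<close> to
    \<open>B\<close>.\<close>
  have "card {i. i < L \<and> xs ! i \<in> A} \<le> card {i. i < L \<and> xs ! i \<in> B}"
  proof (rule card_inj_on_le)
    show "inj_on (\<lambda>i. Suc i mod L) {i. i < L \<and> xs ! i \<in> A}"
    proof (rule inj_onI)
      fix i j
      assume "i \<in> {i. i < L \<and> xs ! i \<in> A}" "j \<in> {i. i < L \<and> xs ! i \<in> A}" "Suc i mod L = Suc j mod L"
      then show "i = j"
        by (cases "Suc i = L"; cases "Suc j = L") auto
    qed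
    show "(\<lambda>i. Suc i mod L) ` {i. i < L \<and> xs ! i \<in> A} \<subseteq> {i. i < L \<and> xs ! i \<in> B}"
    proof (rule image_subsetI)
      fix i assume i: "i \<in> {i. i < L \<and> xs ! i \<in> A}"
      then have "H (xs ! i) (xs ! (Suc i mod L))"
        using is_cycle_nth[OF assms(1)] by (simp add: L_def)
      then have "xs ! (Suc i mod L) \<in> B" using assms(2,3) i by blast
      moreover have "Suc i mod L < L" using i by (intro mod_less_divisor) auto
      ultimately show "Suc i mod L \<in> {i. i < L \<and> xs ! i \<in> B}" by simp
    qed
  qed simp
  then show ?thesis by (simp add: ix)
qed

text \<open>If no extension is possible, the neighborhoods outside the cycle of \<open>a\<close> and of the successors
  of its neighbors on the cycle are pairwise disjoint, and \<open>B\<close> is too small for that.\<close>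

lemma jackson_extend:
  assumes sym: "symp H"
    and bip: "\<And>x y. H x y \<Longrightarrow> (x \<in> A \<and> y \<in> B) \<or> (x \<in> B \<and> y \<in> A)"
    and fin: "finite A" "finite B" and disj: "A \<inter> B = {}"
    and deg: "\<And>a. a \<in> A \<Longrightarrow> k \<le> card {b \<in> B. H a b}"
    and B: "card B + 2 \<le> 2 * k" and A: "k \<le> card A"
    and cyc: "is_cycle H xs" "length xs = 2 * m" and m: "2 \<le> m" "m < k"
  shows "\<exists>ys. is_cycle H ys \<and> length ys = 2 * m + 2"
proof (rule ccontr)
  assume no: "\<not> ?thesis"
  define C where "C = set xs"
  define out where "out a = {b \<in> B - C. H a b}" for a
  define L where "L = length xs"
  have L: "L = 2 * m" by (simp add: L_def cyc)
  have d: "distinct xs" using cyc(1) by (simp add: is_cycle_def)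
  have nth: "H (xs ! i) (xs ! (Suc i mod L))" if "i < L" for i
    using is_cycle_nth[OF cyc(1)] that by (simp add: L_def)
  have CAB: "C \<subseteq> A \<union> B"
    using is_cycle_subset[OF cyc(1), of "A \<union> B"] bip by (auto simp: C_def)
  have cardC: "card C = 2 * m" using d cyc(2) by (simp add: C_def distinct_card)
  have "card (C \<inter> A) = card (C \<inter> B)"
  proof (rule antisym)
    show "card (C \<inter> A) \<le> card (C \<inter> B)"
      using bipartite_cycle_card[OF cyc(1) bip disj] by (simp add: C_def)
    have "B \<inter> A = {}" using disj by blast
    then show "card (C \<inter> B) \<le> card (C \<inter> A)"
      using bipartite_cycle_card[OF cyc(1), of B A] bip by (auto simp: C_def)
  qed
  moreover have "card (C \<inter> A) + card (C \<inter> B) = card C"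
  proof -
    have "C = (C \<inter> A) \<union> (C \<inter> B)" using CAB by blast
    then show ?thesis
      using card_Un_disjoint[of "C \<inter> A" "C \<inter> B"] disj by (metis C_def List.finite_set Int_assoc Int_empty_right finite_Int inf_left_commute)
  qed
  ultimately have cardCA: "card (C \<inter> A) = m" and cardCB: "card (C \<inter> B) = m"
    using cardC by auto
  have cardout: "card (B - C) = card B - m"
    using cardCB fin by (simp add: card_Diff_subset_Int Int_commute)
  have mB: "m \<le> card B" using cardCB fin by (metis card_mono inf_le2)
  have out_split: "card {b \<in> B. H a b} = card {b \<in> C \<inter> B. H a b} + card (out a)" for a
  proof -
    have eq: "{b \<in> B. H a b} = {b \<in> C \<inter> B. H a b} \<union> out a" by (auto simp: out_def)
    show ?thesis unfolding eq by (rule card_Un_disjoint) (use fin in \<open>auto simp: out_def\<close>)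
  qed
  have out_ge: "k - m \<le> card (out a)" if "a \<in> A" for a
  proof -
    have "card {b \<in> C \<inter> B. H a b} \<le> m"
      using cardCB fin by (metis (no_types, lifting) card_mono finite_Int mem_Collect_eq subsetI)
    then show ?thesis using deg[OF that] out_split[of a] by simp
  qed
  have out_sub: "out a \<subseteq> B - C" "finite (out a)" for a using fin by (auto simp: out_def)
  have "\<not> A \<subseteq> C \<inter> A"
    using card_mono[of "C \<inter> A" A] cardCA m A fin by auto
  then obtain a where a: "a \<in> A" "a \<notin> C" by blast
  define D where "D = {i. i < L \<and> H a (xs ! i)}"
  define s where "s i = xs ! (Suc i mod L)" for i
  have finD: "finite D" by (simp add: D_def)
  have cardD: "card {b \<in> C \<inter> B. H a b} = card D"
  proof -
    have "{b \<in> C \<inter> B. H a b} = (!) xs ` D"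
      using bip[of a] a disj by (auto simp: D_def C_def L_def in_set_conv_nth)
    moreover have "inj_on ((!) xs) D"
      using d by (auto simp: inj_on_def D_def L_def nth_eq_iff_index_eq)
    ultimately show ?thesis by (simp add: card_image)
  qed
  have Lpos: "0 < L" using L m by simp
  show False
  proof (cases "D = {}")
    \<comment> \<open>All neighbors of \<open>a\<close> in \<open>B\<close>, at least
      \<open>k\<close>, are off the cycle. The aim is to replace one cycle vertex \<open>b\<close>
      of \<open>B\<close> by a path \<open>c2\<close>, \<open>a\<close>, \<open>c1\<close>.\<close>
    case True
    then have outa: "k \<le> card (out a)"
      using deg[OF a(1)] out_split[of a] cardD by simp
    have "C \<inter> B \<noteq> {}" using cardCB m by auto
    then obtain i where i: "i < L" "xs ! i \<in> B" by (auto simp: C_def L_def in_set_conv_nth)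
    obtain ys where ys: "is_cycle H ys" "set ys = set xs" "length ys = length xs" "last ys = xs ! i"
      using is_cycle_rotate_at[OF cyc(1)] i(1) unfolding L_def by blast
    obtain b1 us b where us: "ys = b1 # us @ [b]" "us \<noteq> []"
    proof -
      have len: "4 \<le> length ys" using ys(3) cyc(2) m by simp
      obtain b1 vs where vs: "ys = b1 # vs" using len by (cases ys) auto
      obtain us b where "vs = us @ [b]" using len vs by (cases vs rule: rev_cases) auto
      then show ?thesis using vs len by (intro that[of b1 us b]) auto
    qed
    define b2 where "b2 = last us"
    have H: "H b2 b" "H b b1" "H b1 (hd us)" "successively H us"
      using ys(1) us by (simp_all add: is_cycle_def successively_append_iff successively_Cons b2_def)
    have bB: "b \<in> B" using ys(4) us i by simp
    have b12: "b1 \<in> A" "b2 \<in> A"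
      using bip[OF H(1)] bip[OF H(2)] bB disj by auto
    \<comment> \<open>Inclusion-exclusion in \<open>B - C\<close> gives at least
      \<open>k + (k - m) - (card B - m)\<close>, that is \<open>2 * k - card B\<close>, common
      neighbors.\<close>
    have two: "2 \<le> card (out a \<inter> out x)" if "x \<in> A" for x
    proof -
      have "card (out a) + card (out x) = card (out a \<union> out x) + card (out a \<inter> out x)"
        by (rule card_Un_Int) (use out_sub in auto)
      moreover have "card (out a \<union> out x) \<le> card (B - C)"
        using out_sub[of a] out_sub[of x] fin by (intro card_mono) auto
      ultimately show ?thesis using outa out_ge[OF that] cardout B m mB by linarith
    qed
    have "out a \<inter> out b1 \<noteq> {}" using two[OF b12(1)] by auto
    then obtain c1 where c1: "c1 \<in> out a" "c1 \<in> out b1" by blast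
    have "\<not> out a \<inter> out b2 \<subseteq> {c1}"
      using two[OF b12(2)] card_mono[of "{c1}" "out a \<inter> out b2"] by auto
    then obtain c2 where c2: "c2 \<in> out a" "c2 \<in> out b2" "c2 \<noteq> c1" by blast
    have "successively H (b1 # us @ [c2, a, c1])"
      using H(3,4) us(2) c1 c2 sym
      by (auto simp: successively_append_iff successively_Cons out_def symp_def b2_def)
    moreover have "distinct (b1 # us @ [c2, a, c1])"
      using ys(1) ys(2)[symmetric] us c1 c2 a disj by (auto simp: is_cycle_def out_def C_def)
    moreover have "H (last (b1 # us @ [c2, a, c1])) (hd (b1 # us @ [c2, a, c1]))"
      using c1 sym by (simp add: out_def symp_def)
    ultimately have "is_cycle H (b1 # us @ [c2, a, c1])" by (simp only: is_cycle_def simp_thms)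
    moreover have "length (b1 # us @ [c2, a, c1]) = 2 * m + 2"
      using us ys(3) cyc(2) by simp
    ultimately show False using no by blast
  next
    case False
    have sA: "s i \<in> A" if "i \<in> D" for i
      using that nth[of i] bip[of a "xs ! i"] bip[of "xs ! i" "s i"] a disj by (auto simp: D_def s_def)
    have disj1: "out a \<inter> out (s i) = {}" if "i \<in> D" for i
    proof (rule ccontr)
      assume "\<not> ?thesis"
      then obtain c where c: "c \<in> out a" "c \<in> out (s i)" by blast
      have "i < length xs" using that by (simp add: D_def L_def)
      then obtain ys where ys: "is_cycle H ys" "set ys = set xs" "length ys = length xs"
        "last ys = xs ! i" "hd ys = s i"
        using is_cycle_rotate_at[OF cyc(1)] unfolding L_def s_def by blast
      have "ys \<noteq> []" using ys(3) cyc(2) m by auto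
      then have "is_cycle H (ys @ [a, c])"
        using ys c a that sym disj
        by (intro is_cycle_insert_edge) (auto simp: out_def C_def D_def symp_def)
      moreover have "length (ys @ [a, c]) = 2 * m + 2" using ys(3) cyc(2) by simp
      ultimately show False using no by blast
    qed
    have disj2: "out (s i) \<inter> out (s j) = {}" if "i \<in> D" "j \<in> D" "i \<noteq> j" for i j
    proof (rule ccontr)
      assume "\<not> ?thesis"
      then obtain c where c: "c \<in> out (s i)" "c \<in> out (s j)" by blast
      have ij: "i < length xs" "j < length xs" "i \<noteq> j" using that by (simp_all add: D_def L_def)
      obtain as bs where ab: "as \<noteq> []" "bs \<noteq> []" "is_cycle H (as @ bs)" "set (as @ bs) = set xs"
        "length as + length bs = length xs" "last as = xs ! i" "hd bs = s i"
        "last bs = xs ! j" "hd as = s j"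
        using is_cycle_cut_at[OF cyc(1) ij] unfolding L_def s_def by blast
      \<comment> \<open>\<open>c\<close> joins the two successors \<open>s i\<close> and
        \<open>s j\<close>, and \<open>a\<close> joins its own neighbors at positions
        \<open>i\<close> and \<open>j\<close>.\<close>
      have "is_cycle H (rev bs @ c # as @ [a])"
        using ab c a that sym disj is_cycle_rotate[OF ab(3,1,2)]
        by (intro is_cycle_insert_two_twisted) (auto simp: out_def C_def D_def symp_def)
      moreover have "length (rev bs @ c # as @ [a]) = 2 * m + 2" using ab(5) cyc(2) by simp
      ultimately show False using no by blast
    qed
    define X where "X = (\<Union>i\<in>D. out (s i))"
    have "card X = (\<Sum>i\<in>D. card (out (s i)))"
      unfolding X_def using finD out_sub disj2 by (intro card_UN_disjoint) auto
    also have "\<dots> \<ge> card D * (k - m)"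
      using sum_bounded_below[of D "k - m" "\<lambda>i. card (out (s i))"] out_ge sA by simp
    finally have X: "card D * (k - m) \<le> card X" .
    have "out a \<inter> X = {}" using disj1 by (auto simp: X_def)
    then have "card (out a) + card X = card (out a \<union> X)"
      using out_sub finD by (subst card_Un_disjoint) (auto simp: X_def)
    also have "\<dots> \<le> card (B - C)"
      using out_sub fin by (intro card_mono) (auto simp: X_def)
    finally have le: "card (out a) + card D * (k - m) \<le> card B - m" using X cardout by simp
    \<comment> \<open>With \<open>card D = e + 1\<close> and \<open>k = m + q + 1\<close>, the left
      side of \<open>le\<close> is at least \<open>m + 2 * q + e * q + 1\<close>, but
      \<open>card B - m\<close> is at most \<open>m + 2 * q\<close>.\<close>
    have "k \<le> card D + card (out a)" using deg[OF a(1)] out_split[of a] cardD by simp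
    moreover obtain e where e: "card D = Suc e" using False finD by (metis card_eq_0_iff not0_implies_Suc)
    moreover obtain q where q: "k = m + Suc q" using m by (metis add_Suc_right less_imp_Suc_add)
    moreover have "Suc e * Suc q = e * q + e + q + 1" by simp
    ultimately have "card (out a) + (e * q + e + q + 1) \<le> card B - m" "m + Suc q \<le> Suc e + card (out a)"
      using le by simp_all
    then show False using B mB q by linarith
  qed
qed

text \<open>The cycle grows from length 4 by two vertices at a time. For the 4-cycle, two vertices
  of \<open>A\<close> have at least \<open>2 * k - card B\<close>, hence two, common neighbors.
  Passing from \<open>R\<close> to \<open>H\<close> keeps only the edges between \<open>A\<close>
  and \<open>B\<close>.\<close>

lemma jackson_cycle:
  assumes sym: "symp R" and fin: "finite A" "finite B" and disj: "A \<inter> B = {}"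
    and deg: "\<And>a. a \<in> A \<Longrightarrow> k \<le> card {b \<in> B. R a b}"
    and B: "card B + 2 \<le> 2 * k" and A: "k \<le> card A" and k: "2 \<le> k"
  obtains xs where "is_cycle R xs" "length xs = 2 * k"
proof -
  define H where "H x y \<longleftrightarrow> R x y \<and> (x \<in> A \<and> y \<in> B \<or> x \<in> B \<and> y \<in> A)" for x y
  have H: "symp H" "\<And>x y. H x y \<Longrightarrow> (x \<in> A \<and> y \<in> B) \<or> (x \<in> B \<and> y \<in> A)"
    using sym by (auto simp: H_def symp_def)
  have nb: "{b \<in> B. H a b} = {b \<in> B. R a b}" if "a \<in> A" for a
    using that disj by (auto simp: H_def)
  have degH: "k \<le> card {b \<in> B. H a b}" if "a \<in> A" for a
    using deg[OF that] nb[OF that] by simp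
  have "\<exists>xs. is_cycle H xs \<and> length xs = 2 * m" if "2 \<le> m" "m \<le> k" for m
    using that
  proof (induction m rule: dec_induct)
    case base
    obtain S where "S \<subseteq> A" "card S = 2" using obtain_subset_with_card_n[of 2 A] A k by auto
    then obtain a a' where a: "a \<in> A" "a' \<in> A" "a \<noteq> a'" by (auto simp: card_2_iff)
    let ?N = "\<lambda>a. {b \<in> B. H a b}"
    have "card (?N a) + card (?N a') = card (?N a \<union> ?N a') + card (?N a \<inter> ?N a')"
      using fin by (intro card_Un_Int) auto
    moreover have "card (?N a \<union> ?N a') \<le> card B" using fin by (intro card_mono) auto
    ultimately have c: "2 \<le> card (?N a \<inter> ?N a')" using degH[OF a(1)] degH[OF a(2)] B by linarith
    have adj: "H x y" if "x \<in> {a, a'}" "y \<in> ?N a \<inter> ?N a'" for x y using that by blast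
    have a2: "{a, a'} \<inter> (?N a \<inter> ?N a') = {}" "2 \<le> card {a, a'}" using a disj by auto
    show ?case using complete_bipartite_cycle[OF H(1) adj a2 c] by auto
  next
    case (step m)
    then obtain xs where "is_cycle H xs" "length xs = 2 * m" by auto
    from jackson_extend[OF H fin disj degH B A this] step show ?case by simp
  qed
  then obtain xs where xs: "is_cycle H xs" "length xs = 2 * k" using k by blast
  have "is_cycle R xs" by (rule is_cycle_mono[OF xs(1)]) (simp add: H_def)
  then show ?thesis using that xs(2) by blast
qed

section \<open>Cycles in multipartite and nearly bipartite graphs\<close>

text \<open>In a list of \<open>2 * n\<close> vertices sorted by class, a class occupies at most
  \<open>n - 1\<close> consecutive positions, so positions at distance at least \<open>n - 1\<close>
  are adjacent. The cyclic order 0, n, 1, n + 1, ..., n - 1, 2n - 1 takes only such steps.\<close>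

lemma multipartite_cycle:
  fixes g :: "'a \<Rightarrow> nat"
  assumes "symp R" "\<And>x y. x \<in> Y \<Longrightarrow> y \<in> Y \<Longrightarrow> g x \<noteq> g y \<Longrightarrow> R x y" "finite Y"
    and small: "\<And>i. card {x \<in> Y. g x = i} < n" and "2 * n \<le> card Y" "2 \<le> n"
  obtains xs where "is_cycle R xs" "length xs = 2 * n"
proof -
  obtain Y' where Y': "Y' \<subseteq> Y" "card Y' = 2 * n" "finite Y'"
    using obtain_subset_with_card_n[OF assms(5)] by blast
  then obtain xs where xs: "set xs = Y'" "distinct xs" using finite_distinct_list by blast
  define ys where "ys = sort_key g xs"
  have ys: "set ys = Y'" "distinct ys" "sorted (map g ys)" by (simp_all add: ys_def xs)
  have len: "length ys = 2 * n" using ys Y'(2) distinct_card by metis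
  have far: "R (ys ! i) (ys ! j)" if "i + (n - 1) \<le> j" "j < 2 * n" for i j
  proof (rule assms(2))
    show "ys ! i \<in> Y" "ys ! j \<in> Y" using that ys(1) len Y' assms(6) by (auto simp: subset_iff)
    show "g (ys ! i) \<noteq> g (ys ! j)"
    proof
      assume eq: "g (ys ! i) = g (ys ! j)"
      have "g (ys ! t) = g (ys ! i)" if "t \<in> {i..j}" for t
        using sorted_nth_mono[OF ys(3), of i t] sorted_nth_mono[OF ys(3), of t j] that \<open>j < 2 * n\<close> len eq
        by auto
      moreover have "ys ! t \<in> Y" if "t \<in> {i..j}" for t
        using nth_mem[of t ys] ys(1) Y'(1) len \<open>j < 2 * n\<close> that by auto
      ultimately have "(!) ys ` {i..j} \<subseteq> {x \<in> Y. g x = g (ys ! i)}"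
        by blast
      moreover have "inj_on ((!) ys) {i..j}"
        using ys(2) len that(2) by (auto simp: inj_on_def nth_eq_iff_index_eq)
      ultimately have "card {i..j} \<le> card {x \<in> Y. g x = g (ys ! i)}"
        using assms(3) by (intro card_inj_on_le) auto
      then show False using small[of "g (ys ! i)"] that by simp
    qed
  qed
  define zs where "zs = map (\<lambda>j. ys ! (if even j then j div 2 else n + j div 2)) [0..<2 * n]"
  have zlen: "length zs = 2 * n" by (simp add: zs_def)
  have znth: "zs ! j = ys ! (if even j then j div 2 else n + j div 2)" if "j < 2 * n" for j
    using that by (simp add: zs_def)
  have "inj_on (\<lambda>j. ys ! (if even j then j div 2 else n + j div 2)) {0..<2 * n}"
  proof (rule inj_onI)
    fix i j assume ij: "i \<in> {0..<2 * n}" "j \<in> {0..<2 * n}"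
      and "ys ! (if even i then i div 2 else n + i div 2) = ys ! (if even j then j div 2 else n + j div 2)"
    then have "(if even i then i div 2 else n + i div 2) = (if even j then j div 2 else n + j div 2)"
      using ys(2) len by (subst (asm) nth_eq_iff_index_eq) (auto split: if_splits)
    then show "i = j" using ij by (auto split: if_splits elim!: evenE oddE)
  qed
  then have "distinct zs" by (simp add: zs_def distinct_map)
  moreover have "successively R zs"
    unfolding successively_conv_nth zlen
  proof (intro allI impI)
    fix i assume i: "Suc i < 2 * n"
    show "R (zs ! i) (zs ! Suc i)"
    proof (cases "even i")
      case True
      then have "Suc i div 2 = i div 2" by presburger
      then show ?thesis using True i far[of "i div 2" "n + i div 2"] by (simp add: znth)
    next
      case False
      then have "Suc i div 2 = Suc (i div 2)" by presburger
      then show ?thesis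
        using False i far[of "Suc (i div 2)" "n + i div 2"] assms(1,6) by (simp add: znth symp_def)
    qed
  qed
  moreover have "R (last zs) (hd zs)"
  proof -
    have ne: "zs \<noteq> []" using zlen assms(6) by auto
    have "last zs = zs ! (2 * n - 1)" "hd zs = zs ! 0"
      using ne zlen by (simp_all add: last_conv_nth hd_conv_nth)
    moreover have "odd (2 * n - 1)" "(2 * n - 1) div 2 = n - 1" using assms(6) by presburger+
    ultimately show ?thesis
      using far[of 0 "n + (n - 1)"] assms(1,6) by (simp add: znth symp_def)
  qed
  ultimately have "is_cycle R zs" by (simp add: is_cycle_def)
  then show ?thesis using that zlen by blast
qed

text \<open>The path \<open>u\<close>, \<open>v\<close>, \<open>w\<close> inside \<open>X\<close>
  takes the place of one vertex of \<open>X\<close> in an alternating cycle of length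
  \<open>2 * l\<close>.\<close>

lemma path_bipartite_cycle:
  assumes "symp Q" "\<And>x y. x \<in> S \<Longrightarrow> y \<in> X \<Longrightarrow> Q x y" "S \<inter> X = {}"
    and "u \<in> X" "v \<in> X" "w \<in> X" "u \<noteq> v" "v \<noteq> w" "u \<noteq> w" "Q u v" "Q v w"
    and "card S = l" "1 \<le> l" "l + 2 \<le> card X"
  obtains xs where "is_cycle Q xs" "length xs = 2 * l + 2"
proof -
  obtain ss where ss: "distinct ss" "set ss \<subseteq> S" "length ss = l"
    using obtain_subset_list[of l S] assms(12) by auto
  have "card {u, v, w} = 3" using assms by simp
  then have "l - 1 \<le> card (X - {u, v, w})"
    using diff_card_le_card_Diff[of "{u, v, w}" X] assms(14) by simp
  then obtain xs where xs: "distinct xs" "set xs \<subseteq> X - {u, v, w}" "length xs = l - 1"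
    using obtain_subset_list by blast
  have ne: "ss \<noteq> []" using ss assms(13) by auto
  have adj: "Q x y \<and> Q y x" if "x \<in> set ss" "y \<in> X" for x y
    using assms(1,2) that ss by (meson subsetD sympD)
  have suc: "successively Q (splice ss xs)"
    by (rule successively_splice) (use adj ss xs in auto)
  have last: "last (splice ss xs) = last ss"
    using last_splice[of xs ss] ss(3) xs(3) assms(13) ne by auto
  have dis: "distinct (splice ss xs)"
    using ss xs assms(3) by (intro distinct_splice) blast+
  have "successively Q (u # v # w # splice ss xs)"
    using suc adj[of "hd ss" w] ne assms by (simp add: successively_Cons hd_splice)
  moreover have "distinct (u # v # w # splice ss xs)"
    using dis ss xs assms(3-9) by auto
  moreover have "Q (last (splice ss xs)) u"
    using last ne adj[of "last ss" u] assms(4) by simp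
  ultimately have "is_cycle Q (u # v # w # splice ss xs)"
    using ne by (simp add: is_cycle_def)
  moreover have "length (u # v # w # splice ss xs) = 2 * l + 2"
    using ss(3) xs(3) assms(13) by simp
  ultimately show ?thesis using that by blast
qed

text \<open>One alternating path has \<open>a\<close> vertices in \<open>X\<close> and both ends
  there, the other \<open>b\<close> vertices in \<open>Y\<close> and both ends there, with
  \<open>a + b = l + 2\<close>. Two edges between \<open>X\<close> and \<open>Y\<close> join them to
  a cycle on \<open>(2 * a - 1) + (2 * b - 1)\<close> vertices.\<close>

lemma two_bipartite_cycle:
  assumes "symp Q" "finite X" "finite Y"
    and XY: "\<And>x y. x \<in> X \<Longrightarrow> y \<in> Y \<Longrightarrow> Q x y" "X \<inter> Y = {}"
    and XD: "\<And>x d. x \<in> X \<Longrightarrow> d \<in> D \<Longrightarrow> Q x d" and YE: "\<And>y e. y \<in> Y \<Longrightarrow> e \<in> E \<Longrightarrow> Q y e"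
    and disj: "(X \<union> Y) \<inter> (D \<union> E) = {}"
    and ne: "X \<noteq> {}" "Y \<noteq> {}" and cards: "l + 2 \<le> card X + card Y" "card D = l" "card E = l"
  obtains xs where "is_cycle Q xs" "length xs = 2 * l + 2"
proof -
  define a where "a = min (card X) (l + 1)"
  define b where "b = l + 2 - a"
  have "1 \<le> card X" "1 \<le> card Y" using ne assms(2,3) by (simp_all add: Suc_le_eq card_gt_0_iff)
  then have ab: "1 \<le> a" "a \<le> card X" "1 \<le> b" "b \<le> card Y" "a + b = l + 2"
    using cards(1) by (auto simp: a_def b_def)
  obtain xs where xs: "distinct xs" "set xs \<subseteq> X" "length xs = a"
    using obtain_subset_list[OF ab(2)] .
  obtain ys where ys: "distinct ys" "set ys \<subseteq> Y" "length ys = b"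
    using obtain_subset_list[OF ab(4)] .
  have "a - 1 \<le> card D" using cards ab by linarith
  then obtain ds where ds: "distinct ds" "set ds \<subseteq> D" "length ds = a - 1"
    using obtain_subset_list by blast
  \<comment> \<open>\<open>D\<close> and \<open>E\<close> may overlap; the \<open>a - 1\<close>
    vertices already used leave at least \<open>l - (a - 1) = b - 1\<close> in
    \<open>E\<close>.\<close>
  have "b - 1 \<le> card (E - set ds)"
    using diff_card_le_card_Diff[of "set ds" E] distinct_card[OF ds(1)] ds(3) cards ab by simp
  then obtain es where es: "distinct es" "set es \<subseteq> E - set ds" "length es = b - 1"
    using obtain_subset_list by blast
  have ne: "xs \<noteq> []" "ys \<noteq> []" using xs ys ab by auto
  have adj: "Q x d \<and> Q d x" if "x \<in> set xs" "d \<in> set ds" for x d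
    using XD assms(1) that xs ds by (meson subsetD sympD)
  have adj': "Q y e \<and> Q e y" if "y \<in> set ys" "e \<in> set es" for y e
    using YE assms(1) that ys es by (meson DiffD1 subsetD sympD)
  have s1: "successively Q (splice xs ds)" by (rule successively_splice) (use adj xs ds ab in auto)
  have s2: "successively Q (splice ys es)" by (rule successively_splice) (use adj' ys es ab in auto)
  have l1: "last (splice xs ds) = last xs"
    using last_splice[of ds xs] xs(3) ds(3) ab ne by auto
  have l2: "last (splice ys es) = last ys"
    using last_splice[of es ys] ys(3) es(3) ab ne by auto
  have j1: "Q (last xs) (hd ys)" using XY(1) xs ys ne by (simp add: subsetD)
  have j2: "Q (last ys) (hd xs)" using XY(1)[of "hd xs" "last ys"] assms(1) xs ys ne by (simp add: subsetD symp_def)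
  have d1: "distinct (splice xs ds)" using xs ds disj by (intro distinct_splice) blast+
  have d2: "distinct (splice ys es)" using ys es disj by (intro distinct_splice) blast+
  have "set (splice xs ds) \<inter> set (splice ys es) = {}"
    using xs(2) ys(2) ds(2) es(2) disj XY(2) unfolding set_splice by blast
  then have "is_cycle Q (splice xs ds @ splice ys es)"
    using s1 s2 l1 l2 j1 j2 d1 d2 ne by (simp add: is_cycle_def successively_append_iff hd_splice)
  moreover have "length (splice xs ds @ splice ys es) = 2 * l + 2"
    using xs(3) ys(3) ds(3) es(3) ab by simp
  ultimately show ?thesis using that by blast
qed

section \<open>Blow-ups of 2-colored complete graphs\<close>

text \<open>\<open>T\<close> is the relation of lying in the same part of the blow-up; edges inside a part are ignored.\<close>

locale two_colored_blowup =
  fixes V :: "'a set" and T R B :: "'a \<Rightarrow> 'a \<Rightarrow> bool" and n :: nat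
  assumes fin: "finite V" and n: "3 \<le> n" and card_V: "4 * n \<le> card V"
    and T_dom: "T x y \<Longrightarrow> x \<in> V" and T_refl: "x \<in> V \<Longrightarrow> T x x"
    and T_sym: "T x y \<Longrightarrow> T y x" and T_trans: "T x y \<Longrightarrow> T y z \<Longrightarrow> T x z"
    and R_dom: "R x y \<Longrightarrow> x \<in> V" and B_dom: "B x y \<Longrightarrow> x \<in> V"
    and R_symp: "symp R" and B_symp: "symp B"
    and total: "x \<in> V \<Longrightarrow> y \<in> V \<Longrightarrow> T x y \<or> R x y \<or> B x y"
    and R_not_T: "R x y \<Longrightarrow> \<not> T x y" and B_not_T: "B x y \<Longrightarrow> \<not> T x y"
    and R_cong: "T x x' \<Longrightarrow> R x y \<Longrightarrow> R x' y" and B_cong: "T x x' \<Longrightarrow> B x y \<Longrightarrow> B x' y"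
    and class_small: "x \<in> V \<Longrightarrow> card {y. T x y} < n"
begin

lemma swap: "two_colored_blowup V T B R n"
proof unfold_locales
  show "T x y \<or> B x y \<or> R x y" if "x \<in> V" "y \<in> V" for x y using total[OF that] by blast
qed (fact fin n card_V T_dom T_refl T_sym T_trans R_dom B_dom R_symp B_symp R_not_T B_not_T
    R_cong B_cong class_small)+

lemma R_sym: "R x y \<Longrightarrow> R y x" and B_sym: "B x y \<Longrightarrow> B y x"
  using R_symp B_symp by (auto dest: sympD)

lemma T_dom': "T x y \<Longrightarrow> y \<in> V"
  using T_dom T_sym by blast

lemma finite_class: "finite {y. T x y}"
  by (rule finite_subset[OF _ fin]) (auto dest: T_dom')

end

text \<open>
  The exceptional vertex \<open>w0\<close> is harmless because \<open>R\<close> has no cycle of length \<open>2 * l + 2\<close>: two outside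
  vertices cannot be inserted into two different edges of the cycle. So all insertions use one
  vertex, or one edge, which is then taken to be the one from the end of \<open>p\<close> back to its start.
\<close>

locale even_cycle_step = two_colored_blowup +
  fixes p :: "'a list" and l :: nat and w0 :: 'a
  assumes cyc: "is_cycle R p" and len: "length p = 2 * l" and l: "2 \<le> l" "l < n"
    and no_R: "is_cycle R ys \<Longrightarrow> length ys \<noteq> 2 * l + 2"
    and no_B: "is_cycle B ys \<Longrightarrow> length ys \<noteq> 2 * l + 2"
    and no_B': "is_cycle B ys \<Longrightarrow> length ys \<noteq> 2 * n"
    and inner: "w \<in> V - set p \<Longrightarrow> w \<noteq> w0 \<Longrightarrow> Suc j < 2 * l \<Longrightarrow> \<not> (R w (p ! j) \<and> R w (p ! Suc j))"
begin

section \<open>Twin classes that meet both the cycle and its complement\<close>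

definition "C = set p"
definition "W = V - C"
text \<open>Outside vertices not in \<open>Z\<close> have no twin on the cycle, hence a color to
  each of its vertices.\<close>

definition "Z = {z \<in> V. (\<exists>c\<in>C. T z c) \<and> (\<exists>w\<in>W. T z w)}"
definition "W1 = W - Z - {w0}"

lemma C_subset: "C \<subseteq> V"
  unfolding C_def by (rule is_cycle_subset[OF cyc R_dom])

lemma finite_sets: "finite C" "finite W" "finite Z" "finite W1"
  using fin by (auto simp: C_def W_def Z_def W1_def)

lemma p_distinct: "distinct p"
  using cyc by (simp add: is_cycle_def)

lemma card_C: "card C = 2 * l"
  using p_distinct len by (simp add: C_def distinct_card)

lemma card_W: "4 * n \<le> card W + 2 * l"
  using card_Diff_subset[OF finite_sets(1) C_subset] card_C card_V by (simp add: W_def)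

lemma nth_C: "i < 2 * l \<Longrightarrow> p ! i \<in> C"
  by (simp add: C_def len)

lemma nth_inj: "i < 2 * l \<Longrightarrow> j < 2 * l \<Longrightarrow> p ! i = p ! j \<Longrightarrow> i = j"
  using p_distinct len by (simp add: nth_eq_iff_index_eq)

lemma no_insert_edge:
  assumes "i < 2 * l" "u \<in> W" "v \<in> W" "u \<noteq> v"
    and "R (p ! i) u" "R u v" "R v (p ! (Suc i mod (2 * l)))"
  shows False
proof -
  have "i < length p" using assms(1) len by simp
  then obtain ys where ys: "is_cycle R ys" "set ys = set p" "length ys = length p"
    "last ys = p ! i" "hd ys = p ! (Suc i mod length p)"
    using is_cycle_rotate_at[OF cyc] by blast
  have "ys \<noteq> []" using ys(3) len l by auto
  then have "is_cycle R (ys @ [u, v])"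
    using ys assms len by (intro is_cycle_insert_edge) (auto simp: W_def C_def)
  moreover have "length (ys @ [u, v]) = 2 * l + 2" using ys(3) len by simp
  ultimately show False using no_R by blast
qed

text \<open>Let \<open>c\<close> on the cycle and \<open>w\<close> outside be twins of
  \<open>z\<close>. If \<open>z y\<close> were red, then so would be \<open>c y\<close> and
  \<open>y w\<close>. As \<open>w\<close> is red to the successor of \<open>c\<close>, the edge
  \<open>y w\<close> could be inserted after \<open>c\<close>.\<close>

lemma Z_W:
  assumes z: "z \<in> Z" and y: "y \<in> W" and nT: "\<not> T z y"
  shows "B z y"
proof (rule ccontr)
  assume "\<not> B z y"
  then have R: "R z y" using total[of z y] z y nT by (auto simp: Z_def W_def)
  obtain c w where c: "c \<in> C" "T z c" and w: "w \<in> W" "T z w" using z by (auto simp: Z_def)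
  obtain i where i: "i < 2 * l" "c = p ! i" using c(1) len by (auto simp: C_def in_set_conv_nth)
  have "R c y" "R y w" using R c(2) w(2) R_cong R_sym by blast+
  moreover have "R w (p ! (Suc i mod (2 * l)))"
    using is_cycle_nth[OF cyc, of i] i len c(2) w(2) R_cong T_sym by metis
  moreover have "y \<noteq> w" using nT w(2) by blast
  ultimately show False using no_insert_edge[OF i(1) y w(1)] i(2) by blast
qed

lemma Z_WZ:
  assumes z: "z \<in> Z" and y: "y \<in> W \<union> Z" and nT: "\<not> T z y"
  shows "B z y"
proof (cases "y \<in> W")
  case True
  then show ?thesis using Z_W z nT by blast
next
  case False
  then obtain w where w: "w \<in> W" "T y w" using y by (auto simp: Z_def)
  then have "B z w" using Z_W[OF z w(1)] nT T_trans T_sym by blast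
  then show ?thesis using w(2) B_cong B_sym T_sym by blast
qed

lemma no_twins:
  assumes "w \<in> W - Z"
  shows "c \<in> C \<Longrightarrow> \<not> T w c" "z \<in> Z \<Longrightarrow> \<not> T z w"
proof -
  have w: "w \<in> V" "w \<in> W" "w \<notin> Z" using assms by (auto simp: W_def)
  show "\<not> T w c" if "c \<in> C" using that w T_refl unfolding Z_def by blast
  show "\<not> T z w" if z: "z \<in> Z"
  proof
    assume zw: "T z w"
    obtain c where "c \<in> C" "T z c" using z by (auto simp: Z_def)
    then have "T w c" using zw T_sym T_trans by blast
    then show False using \<open>c \<in> C\<close> w T_refl unfolding Z_def by blast
  qed
qed

text \<open>Otherwise blue contains a complete multipartite graph on \<open>W \<union> Z\<close>
  whose parts are \<open>W - Z\<close> and the twin classes within \<open>Z\<close>. All parts have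
  fewer than \<open>n\<close> vertices, and \<open>W\<close> alone has at least
  \<open>2 * n\<close>.\<close>

lemma card_W_minus_Z: "n \<le> card (W - Z)"
proof (rule ccontr)
  assume small: "\<not> n \<le> card (W - Z)"
  obtain f :: "'a \<Rightarrow> nat" where f: "inj_on f V"
    using finite_imp_inj_to_nat_seg[OF fin] by auto
  \<comment> \<open>Numbers the parts: 0 for \<open>W - Z\<close>, and for a vertex of
    \<open>Z\<close> a positive number identifying its twin class.\<close>
  define g where "g x = (if x \<in> Z then Suc (Min (f ` {y. T x y})) else 0)" for x
  have g_class: "T x y" if "x \<in> Z" "y \<in> Z" "g x = g y" for x y
  proof -
    have ne: "T x x" "T y y" using that T_refl by (auto simp: Z_def)
    have "Min (f ` {u. T x u}) \<in> f ` {u. T x u}" "Min (f ` {u. T y u}) \<in> f ` {u. T y u}"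
      using finite_class ne by (auto intro!: Min_in)
    moreover have "Min (f ` {u. T x u}) = Min (f ` {u. T y u})" using that by (simp add: g_def)
    ultimately obtain u v where "T x u" "T y v" "f u = f v"
      by (metis (no_types, lifting) imageE mem_Collect_eq)
    then show ?thesis using f T_dom' T_sym T_trans by (metis inj_onD)
  qed
  have adj: "B x y" if "x \<in> W \<union> Z" "y \<in> W \<union> Z" "g x \<noteq> g y" for x y
  proof -
    have "\<not> T x y"
    proof
      assume xy: "T x y"
      have "T x = T y" using xy T_sym T_trans by blast
      moreover have "x \<in> Z \<longleftrightarrow> y \<in> Z"
        using no_twins(2)[of y x] no_twins(2)[of x y] xy T_sym that by blast
      ultimately have "g x = g y" by (cases "y \<in> Z") (simp_all add: g_def)
      then show False using that(3) by blast
    qed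
    moreover have "x \<in> Z \<or> y \<in> Z" using that(3) by (metis g_def)
    ultimately show ?thesis using Z_WZ that T_sym B_sym by blast
  qed
  have fiber: "card {x \<in> W \<union> Z. g x = i} < n" for i
  proof (cases "{x \<in> Z. g x = i} = {}")
    case True
    then have "{x \<in> W \<union> Z. g x = i} \<subseteq> W - Z" by auto
    then have "card {x \<in> W \<union> Z. g x = i} \<le> card (W - Z)"
      using finite_sets by (intro card_mono) auto
    then show ?thesis using small by simp
  next
    case False
    then obtain x where x: "x \<in> Z" "g x = i" by blast
    then have "{x \<in> W \<union> Z. g x = i} \<subseteq> {y. T x y}"
      using g_class[of x] by (auto simp: g_def split: if_splits)
    then have "card {x \<in> W \<union> Z. g x = i} \<le> card {y. T x y}"
      using finite_class by (intro card_mono) auto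
    then show ?thesis using class_small[of x] x by (simp add: Z_def)
  qed
  have "card W \<le> card (W \<union> Z)" using finite_sets by (intro card_mono) auto
  then have "2 * n \<le> card (W \<union> Z)" using card_W l by linarith
  then obtain xs where "is_cycle B xs" "length xs = 2 * n"
    using multipartite_cycle[OF B_symp adj _ fiber] finite_sets n by auto
  then show False using no_B' by blast
qed

text \<open>All edges between \<open>Z\<close> and \<open>W - Z\<close> are blue, and
  \<open>W - Z\<close> has at least \<open>n\<close> vertices.\<close>

lemma card_Z: "card Z < n"
proof (rule ccontr)
  assume "\<not> card Z < n"
  moreover have "B z y" if "z \<in> Z" "y \<in> W - Z" for z y
    using that Z_W no_twins(2) by blast
  ultimately obtain xs where "is_cycle B xs" "length xs = 2 * n"
    using complete_bipartite_cycle[OF B_symp, of Z "W - Z" n] card_W_minus_Z n by auto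
  then show False using no_B' by blast
qed

lemma W1_outside: "w \<in> W1 \<Longrightarrow> w \<in> W - Z" "w \<in> W1 \<Longrightarrow> w \<in> V - set p" "w \<in> W1 \<Longrightarrow> w \<noteq> w0"
  by (auto simp: W1_def W_def C_def)

lemma W1_color: "w \<in> W1 \<Longrightarrow> c \<in> C \<Longrightarrow> \<not> R w c \<Longrightarrow> B w c"
  using total[of w c] no_twins(1)[of w c] W1_outside[of w] C_subset by blast

section \<open>Outside vertices by their red neighbors on the cycle\<close>

text \<open>
  A vertex whose red neighbors on the path \<open>p\<close> are independent and as many as possible picks the
  even positions up to some point and the odd positions from there on.
\<close>

definition typed :: "'a \<Rightarrow> nat \<Rightarrow> bool" where
  "typed w s \<longleftrightarrow> s \<le> l \<and> (\<forall>i<l. (R w (p ! (2 * i)) \<longleftrightarrow> i < s) \<and> (R w (p ! (2 * i + 1)) \<longleftrightarrow> s \<le> i))"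

text \<open>One position from each pair \<open>2 * i\<close>, \<open>2 * i + 1\<close>: the one to
  which a vertex of type \<open>s\<close> is red. The set \<open>blues s\<close> is the complement
  within the cycle.\<close>

definition "reds s = (\<lambda>i. p ! (if i < s then 2 * i else 2 * i + 1)) ` {..<l}"
definition "blues s = (\<lambda>i. p ! (if i < s then 2 * i + 1 else 2 * i)) ` {..<l}"

lemma card_reds: "card (reds s) = l" and card_blues: "card (blues s) = l"
proof -
  have inj: "inj_on (\<lambda>i. p ! h i) {..<l}" if "\<And>i. h i = 2 * i \<or> h i = 2 * i + 1" for h
  proof (rule inj_onI)
    fix i j assume ij: "i \<in> {..<l}" "j \<in> {..<l}" and eq: "p ! h i = p ! h j"
    have "h i < 2 * l" "h j < 2 * l" using that[of i] that[of j] ij by auto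
    then have "h i = h j" using nth_inj eq by blast
    then show "i = j" using that[of i] that[of j] by presburger
  qed
  have "inj_on (\<lambda>i. p ! (if i < s then 2 * i else 2 * i + 1)) {..<l}"
    "inj_on (\<lambda>i. p ! (if i < s then 2 * i + 1 else 2 * i)) {..<l}"
    by (rule inj; simp)+
  then show "card (reds s) = l" "card (blues s) = l"
    unfolding reds_def blues_def by (simp_all only: card_image card_lessThan)
qed

lemma reds_subset: "reds s \<subseteq> C" and blues_subset: "blues s \<subseteq> C"
  using nth_C by (auto simp: reds_def blues_def)

lemma typed_reds: "typed w s \<Longrightarrow> c \<in> reds s \<Longrightarrow> R w c"
  by (auto simp: typed_def reds_def)

lemma typed_blues: "typed w s \<Longrightarrow> c \<in> blues s \<Longrightarrow> \<not> R w c"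
  by (auto simp: typed_def blues_def)

text \<open>The cycle splits into \<open>l\<close> pairs of consecutive vertices, and by
  \<open>inner\<close> no pair is all red to \<open>w\<close>. If some pair has no red vertex, at
  least \<open>l + 1\<close> vertices are blue. Otherwise each pair has exactly one, and once it is
  the odd one, the next even position is not red, so the odd ones continue.\<close>

lemma typed_or_blue:
  assumes w: "w \<in> W1"
  shows "(\<exists>s. typed w s) \<or> l + 1 \<le> card {c \<in> C. B w c}"
proof (cases "\<exists>i<l. \<not> R w (p ! (2 * i)) \<and> \<not> R w (p ! (2 * i + 1))")
  case True
  then obtain i0 where i0: "i0 < l" "\<not> R w (p ! (2 * i0))" "\<not> R w (p ! (2 * i0 + 1))" by blast
  define h where "h i = (if R w (p ! (2 * i)) then 2 * i + 1 else 2 * i)" for i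
  have h: "h i = 2 * i \<or> h i = 2 * i + 1" for i by (simp add: h_def)
  \<comment> \<open>One non-red position from each pair, and also the second one from the pair
    \<open>i0\<close>, where \<open>h i0 = 2 * i0\<close>.\<close>
  define J where "J = insert (2 * i0 + 1) (h ` {..<l})"
  have "inj_on h {..<l}"
  proof (rule inj_onI)
    fix i j assume "h i = h j"
    then show "i = j" using h[of i] h[of j] by presburger
  qed
  moreover have "2 * i0 + 1 \<notin> h ` {..<l}"
  proof
    assume "2 * i0 + 1 \<in> h ` {..<l}"
    then obtain i where i: "2 * i0 + 1 = h i" by blast
    then have "i = i0" using h[of i] by presburger
    then show False using i i0(2) by (simp add: h_def)
  qed
  ultimately have cardJ: "card J = l + 1" by (simp add: J_def card_image)
  have J: "j < 2 * l \<and> \<not> R w (p ! j)" if j: "j \<in> J" for j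
  proof -
    consider "j = 2 * i0 + 1" | i where "i < l" "j = h i" using j unfolding J_def by blast
    then show ?thesis
    proof cases
      case 2
      then show ?thesis
        using inner[of w "2 * i"] W1_outside[OF w] by (auto simp: h_def)
    qed (use i0 in auto)
  qed
  have "(!) p ` J \<subseteq> {c \<in> C. B w c}" using J nth_C W1_color[OF w] by blast
  moreover have "inj_on ((!) p) J" using J nth_inj by (meson inj_onI)
  ultimately have "card J \<le> card {c \<in> C. B w c}"
    using finite_sets by (intro card_inj_on_le) auto
  then show ?thesis using cardJ by simp
next
  case False
  have one: "R w (p ! (2 * i)) \<longleftrightarrow> \<not> R w (p ! (2 * i + 1))" if "i < l" for i
    using False that inner[of w "2 * i"] W1_outside[OF w] by auto
  have nxt: "\<not> R w (p ! (2 * Suc i))" if "Suc i < l" "R w (p ! (2 * i + 1))" for i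
    using inner[of w "2 * i + 1"] W1_outside[OF w] that by auto
  let ?stop = "\<lambda>i. i = l \<or> \<not> R w (p ! (2 * i))"
  define s where "s = (LEAST i. ?stop i)"
  have s: "s \<le> l" "s = l \<or> \<not> R w (p ! (2 * s))"
    using Least_le[of ?stop l] LeastI[of ?stop l] by (simp_all add: s_def)
  have lo: "R w (p ! (2 * i))" if "i < s" for i
    using not_less_Least[of i ?stop] that by (simp add: s_def)
  have hi: "i < l \<longrightarrow> \<not> R w (p ! (2 * i))" if "s \<le> i" for i
    using that
  proof (induction i rule: dec_induct)
    case base
    then show ?case using s by blast
  next
    case (step i)
    then show ?case using one[of i] nxt[of i] by auto
  qed
  have "typed w s"
    unfolding typed_def
  proof (intro conjI allI impI)
    fix i assume i: "i < l"
    show r: "R w (p ! (2 * i)) \<longleftrightarrow> i < s" using lo hi i not_less by blast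
    show "R w (p ! (2 * i + 1)) \<longleftrightarrow> s \<le> i" using r one[OF i] by auto
  qed (use s in simp)
  then show ?thesis by blast
qed

text \<open>Suppose \<open>s\<close> exceeds \<open>s' + 1\<close>, and cut the cycle behind
  position \<open>2 * s' + 1\<close>. Both pieces start at red neighbors of \<open>w\<close> and end
  at red neighbors of \<open>w'\<close>, so a twisted insertion gives a red cycle of length
  \<open>2 * l + 2\<close>.\<close>

lemma types_close:
  assumes w: "w \<in> W1" "typed w s" and w': "w' \<in> W1" "typed w' s'"
  shows "s \<le> Suc s'"
proof (rule ccontr)
  assume "\<not> s \<le> Suc s'"
  then have s: "Suc s' < s" "s \<le> l" using w(2) by (auto simp: typed_def)
  let ?as = "take (2 * s' + 2) p" and ?bs = "drop (2 * s' + 2) p"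
  have ne: "?as \<noteq> []" "?bs \<noteq> []" using s len by auto
  have ends: "hd ?as = p ! (2 * 0)" "hd ?bs = p ! (2 * Suc s')" "last ?as = p ! (2 * s' + 1)"
    "last ?bs = p ! (2 * (l - 1) + 1)"
  proof -
    show "hd ?as = p ! (2 * 0)" using ne by (simp add: hd_conv_nth)
    show "hd ?bs = p ! (2 * Suc s')" using s len by (simp add: hd_drop_conv_nth)
    show "last ?as = p ! (2 * s' + 1)" using s len ne by (simp add: last_conv_nth)
    have "p \<noteq> []" using ne by auto
    moreover have "last ?bs = last p" using ne by simp
    moreover have "2 * (l - 1) + 1 = length p - 1" using l len by simp
    ultimately show "last ?bs = p ! (2 * (l - 1) + 1)" by (simp only: last_conv_nth not_False_eq_True)
  qed
  have "R w (p ! (2 * s'))" "\<not> R w' (p ! (2 * s'))"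
    using w(2) w'(2) s by (simp_all add: typed_def)
  then have "w \<noteq> w'" by blast
  moreover have "R w (hd ?as)" "R w (hd ?bs)"
    unfolding ends using w(2) s l unfolding typed_def by (metis gr_zeroI not_less_zero order_less_le_trans)+
  moreover have "R w' (last ?as)" "R w' (last ?bs)"
  proof -
    have "s' < l" "l - 1 < l" "s' \<le> l - 1" using s by auto
    then show "R w' (last ?as)" "R w' (last ?bs)"
      unfolding ends using w'(2) unfolding typed_def by blast+
  qed
  ultimately have "is_cycle R (rev ?as @ w # ?bs @ [w'])"
    using cyc ne R_sym W1_outside[OF w(1)] W1_outside[OF w'(1)]
    by (intro is_cycle_insert_two_twisted[OF R_symp]) (auto dest: in_set_takeD in_set_dropD)
  moreover have "length (rev ?as @ w # ?bs @ [w']) = 2 * l + 2" using len s by simp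
  ultimately show False using no_R by blast
qed

text \<open>\<open>w'\<close> is red to position \<open>2 * s\<close> and \<open>w\<close> to
  \<open>2 * s + 1\<close>, so a red edge between them could be inserted there. They are not twins
  since \<open>w\<close> is not red to position \<open>2 * s\<close>.\<close>

lemma types_blue:
  assumes w: "w \<in> W1" "typed w s" and w': "w' \<in> W1" "typed w' s'" and "s < s'"
  shows "B w w'"
proof -
  have s: "s < l" using assms by (auto simp: typed_def)
  have R: "R w' (p ! (2 * s))" "\<not> R w (p ! (2 * s))" "R w (p ! (2 * s + 1))"
    using w(2) w'(2) s assms(5) by (simp_all add: typed_def)
  have "\<not> T w w'" using R R_cong T_sym by blast
  moreover have "\<not> R w w'"
    using no_insert_edge[of "2 * s" w' w] R R_sym s W1_outside[OF w(1)] W1_outside[OF w'(1)] by auto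
  moreover have "w \<in> V" "w' \<in> V" using W1_outside(2) w(1) w'(1) by blast+
  ultimately show ?thesis using total by blast
qed

text \<open>A vertex \<open>w\<close> of \<open>Z\<close> outside the cycle is blue to all of
  \<open>W1\<close>. It replaces a cycle vertex \<open>y\<close> to which every typed vertex is red.
  In the resulting set of \<open>2 * l\<close> vertices every vertex of \<open>W1\<close> has at
  least \<open>l + 1\<close> blue neighbors, and Jackson's theorem applies.\<close>

lemma Z_empty: "Z = {}"
proof (rule ccontr)
  assume "Z \<noteq> {}"
  then obtain z c w where z: "z \<in> Z" "c \<in> C" "T z c" "w \<in> W" "T z w" by (auto simp: Z_def)
  have wZ: "w \<in> Z" using no_twins(2)[of w z] z by blast
  have cZ: "c \<in> Z"
    using z T_sym T_trans T_dom' T_refl unfolding Z_def by blast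
  have "Z \<inter> W \<subseteq> Z - {c}" using z by (auto simp: W_def)
  then have "card (Z \<inter> W) \<le> card Z - 1"
    using card_mono[of "Z - {c}" "Z \<inter> W"] finite_sets cZ by simp
  moreover have "card (W - Z) = card W - card (Z \<inter> W)"
    using finite_sets by (simp add: card_Diff_subset_Int Int_commute)
  moreover have "card (W - Z) - 1 \<le> card W1"
    unfolding W1_def using diff_card_le_card_Diff[of "{w0}" "W - Z"] by simp
  ultimately have card_W1: "l + 1 \<le> card W1"
    using card_W card_Z l n by linarith
  \<comment> \<open>If type 0 occurs, all types are at most 1, hence at most \<open>l - 1\<close>,
    and \<open>y\<close> is the last vertex of \<open>p\<close>. Otherwise all types are positive
    and \<open>y\<close> is the first vertex.\<close>
  obtain y where y: "y \<in> C" "\<And>w s. w \<in> W1 \<Longrightarrow> typed w s \<Longrightarrow> R w y"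
  proof (cases "\<exists>w\<in>W1. typed w 0")
    case True
    then obtain w' where w': "w' \<in> W1" "typed w' 0" by blast
    show ?thesis
    proof (rule that)
      show "p ! (2 * (l - 1) + 1) \<in> C" using l by (intro nth_C) auto
      fix w s assume "w \<in> W1" "typed w s"
      moreover from this have "s \<le> l - 1" using types_close w' l by fastforce
      moreover have "l - 1 < l" using l by simp
      ultimately show "R w (p ! (2 * (l - 1) + 1))" unfolding typed_def by blast
    qed
  next
    case False
    show ?thesis
    proof (rule that)
      show "p ! (2 * 0) \<in> C" using l by (intro nth_C) auto
      fix w s assume w: "w \<in> W1" "typed w s"
      then have "0 < s" using False by (cases s) auto
      moreover have "0 < l" using l by simp
      ultimately show "R w (p ! (2 * 0))" using w unfolding typed_def by blast
    qed
  qed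
  let ?D = "insert w (C - {y})"
  have wC: "w \<notin> C" using z by (simp add: W_def)
  have deg: "l + 1 \<le> card {d \<in> ?D. B u d}" if u: "u \<in> W1" for u
  proof -
    have uw: "B u w" using Z_W[of w u] wZ W1_outside[OF u] no_twins(2)[of u w] B_sym by blast
    have "\<exists>S. S \<subseteq> {d \<in> C - {y}. B u d} \<and> l \<le> card S"
    proof (cases "\<exists>s. typed u s")
      case True
      then obtain s where s: "typed u s" by blast
      have "blues s \<subseteq> {d \<in> C - {y}. B u d}"
        using blues_subset typed_blues[OF s] W1_color[OF u] y(2)[OF u s] by blast
      then show ?thesis using card_blues by (metis order_refl)
    next
      case False
      then have "l + 1 \<le> card {c \<in> C. B u c}" using typed_or_blue[OF u] by blast
      then have "l \<le> card ({c \<in> C. B u c} - {y})"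
        using diff_card_le_card_Diff[of "{y}" "{c \<in> C. B u c}"] by simp
      moreover have "{c \<in> C. B u c} - {y} \<subseteq> {d \<in> C - {y}. B u d}" by blast
      ultimately show ?thesis by blast
    qed
    then obtain S where S: "S \<subseteq> {d \<in> C - {y}. B u d}" "l \<le> card S" by blast
    have finS: "finite S" by (rule finite_subset[OF S(1)]) (use finite_sets in simp)
    have "w \<notin> S" using S(1) wC by blast
    then have "l + 1 \<le> card (insert w S)" using S finS by simp
    also have "\<dots> \<le> card {d \<in> ?D. B u d}"
      using S(1) uw finite_sets by (intro card_mono) auto
    finally show ?thesis .
  qed
  have "card ?D = 2 * l"
    using card_C y(1) finite_sets wC l by simp
  then have "card ?D + 2 \<le> 2 * (l + 1)" "2 \<le> l + 1" "finite ?D"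
    using l finite_sets by simp_all
  moreover have "W1 \<inter> ?D = {}" using wZ unfolding W1_def W_def by blast
  ultimately obtain xs where "is_cycle B xs" "length xs = 2 * (l + 1)"
    using jackson_cycle[OF B_symp finite_sets(4) _ _ deg _ card_W1] by metis
  then show False using no_B by fastforce
qed

section \<open>Closing a longer cycle through the typed vertices\<close>

definition "L = {w \<in> W1. \<exists>s. typed w s}"

text \<open>By Jackson's theorem at most \<open>l\<close> vertices of \<open>W1\<close> are untyped,
  as each of those has \<open>l + 1\<close> blue neighbors among the \<open>2 * l\<close> cycle
  vertices. This leaves at least \<open>4 * n - 2 * l - 1 - l\<close>, where
  \<open>l \<le> n - 1\<close>.\<close>

lemma card_L: "n + 2 \<le> card L"
proof -
  have "card (W1 - L) \<le> l"
  proof (rule ccontr)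
    assume big: "\<not> card (W1 - L) \<le> l"
    have "l + 1 \<le> card {c \<in> C. B w c}" if "w \<in> W1 - L" for w
      using that typed_or_blue by (auto simp: L_def)
    moreover have "(W1 - L) \<inter> C = {}" by (auto simp: W1_def W_def)
    moreover have "card C + 2 \<le> 2 * (l + 1)" "2 \<le> l + 1" "finite (W1 - L)"
      using card_C l finite_sets by simp_all
    moreover have "l + 1 \<le> card (W1 - L)" using big by simp
    ultimately obtain xs where "is_cycle B xs" "length xs = 2 * (l + 1)"
      using jackson_cycle[OF B_symp, of "W1 - L" C "l + 1"] finite_sets(1) by metis
    then show False using no_B by fastforce
  qed
  moreover have "card (W1 - L) = card W1 - card L"
    using finite_sets by (intro card_Diff_subset) (auto simp: L_def)
  moreover have "card W - 1 \<le> card W1"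
    unfolding W1_def Z_empty using diff_card_le_card_Diff[of "{w0}" W] by simp
  ultimately show ?thesis using card_W l by linarith
qed

lemma L_sets: "finite L" "L \<subseteq> W1" "L \<inter> C = {}" "L \<subseteq> V"
  using finite_sets by (auto simp: L_def W1_def W_def)

text \<open>If only one type occurs, \<open>L\<close> is completely red to \<open>l\<close> cycle
  vertices and completely blue to the other \<open>l\<close>; a monochromatic path on three vertices
  of \<open>L\<close> then closes up. Otherwise exactly two types \<open>t\<close> and
  \<open>t + 1\<close> occur, with blue edges between them, and \<open>two_bipartite_cycle\<close>
  applies.\<close>

lemma contradiction: False
proof (cases "\<exists>s. \<forall>w\<in>L. typed w s")
  case True
  then obtain s where s: "typed w s" if "w \<in> L" for w by blast
  obtain u where u: "u \<in> L" using card_L by fastforce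
  have "card L - card {y. T u y} \<le> card (L - {y. T u y})"
    using finite_class by (intro diff_card_le_card_Diff)
  \<comment> \<open>\<open>L\<close> has at least \<open>n + 2\<close> vertices and the twin class
    of \<open>u\<close> at most \<open>n - 1\<close>. Of three non-twins, two are joined to
    \<open>u\<close> in the same color.\<close>
  then have "3 \<le> card (L - {y. T u y})"
    using card_L class_small[of u] u L_sets by fastforce
  then obtain S where S: "S \<subseteq> L - {y. T u y}" "card S = 3" "finite S"
    using obtain_subset_with_card_n by metis
  have "\<not> (card {v \<in> S. R u v} \<le> 1 \<and> card {v \<in> S. B u v} \<le> 1)"
  proof -
    have "S = {v \<in> S. R u v} \<union> {v \<in> S. B u v}"
      using S(1) total[of u] u L_sets by blast
    then have "card S \<le> card {v \<in> S. R u v} + card {v \<in> S. B u v}" by (metis card_Un_le)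
    then show ?thesis using S(2) by linarith
  qed
  then have two: "2 \<le> card {v \<in> S. R u v} \<or> 2 \<le> card {v \<in> S. B u v}" by linarith
  have core: False
    if Q: "symp Q" "Q = R \<or> Q = B" "2 \<le> card {v \<in> S. Q u v}"
      and D: "\<And>x y. x \<in> D \<Longrightarrow> y \<in> L \<Longrightarrow> Q x y" "D \<subseteq> C" "card D = l" for Q D
  proof -
    obtain P where "P \<subseteq> {v \<in> S. Q u v}" "card P = 2" using obtain_subset_with_card_n[OF Q(3)] by blast
    then obtain v w where vw: "v \<in> S" "w \<in> S" "v \<noteq> w" "Q u v" "Q u w" by (auto simp: card_2_iff)
    have ne: "v \<noteq> u" "u \<noteq> w" using vw S(1) T_refl u L_sets by blast+
    have vu: "Q v u" using Q(1) vw(4) by (rule sympD)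
    have DL: "D \<inter> L = {}" using D(2) L_sets by blast
    have vwL: "v \<in> L" "w \<in> L" using vw S(1) by blast+
    have ll: "1 \<le> l" "l + 2 \<le> card L" using card_L l by linarith+
    obtain xs where "is_cycle Q xs" "length xs = 2 * l + 2"
      using path_bipartite_cycle[OF Q(1) D(1) DL vwL(1) u vwL(2) ne vw(3) vu vw(5) D(3) ll] .
    then show False using no_R no_B Q(2) by blast
  qed
  have adjR: "R x y" if "x \<in> reds s" "y \<in> L" for x y
    using typed_reds[OF s] that R_sym by blast
  have adjB: "B x y" if "x \<in> blues s" "y \<in> L" for x y
    using typed_blues[OF s] that B_sym W1_color blues_subset L_sets by blast
  show False
    using two core[OF R_symp _ _ adjR reds_subset card_reds] core[OF B_symp _ _ adjB blues_subset card_blues]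
    by auto
next
  case False
  have "L \<noteq> {}" using card_L by auto
  then obtain w s where w: "w \<in> L" "typed w s" unfolding L_def by blast
  obtain w' s' where w': "w' \<in> L" "typed w' s'" "s' \<noteq> s"
    using False unfolding L_def by blast
  obtain t where t: "\<exists>w\<in>L. typed w t" "\<exists>w\<in>L. typed w (Suc t)"
  proof (cases "s < s'")
    case True
    then have "s' = Suc s" using types_close[of w' s' w s] w w' L_sets by fastforce
    then show ?thesis using that w w' by blast
  next
    case False
    then have "s = Suc s'" using types_close[of w s w' s'] w w' L_sets by fastforce
    then show ?thesis using that w w' by blast
  qed
  let ?X = "{w \<in> L. typed w t}" and ?Y = "{w \<in> L. typed w (Suc t)}"
  have "L = ?X \<union> ?Y"
  proof -
    have "typed u t \<or> typed u (Suc t)" if u: "u \<in> L" for u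
    proof -
      obtain r where r: "typed u r" using u by (auto simp: L_def)
      have "Suc t \<le> Suc r" using t(2) types_close[OF _ _ _ r] u L_sets by blast
      moreover have "r \<le> Suc t" using t(1) types_close[OF _ r] u L_sets by blast
      ultimately have "r = t \<or> r = Suc t" by linarith
      then show ?thesis using r by blast
    qed
    then show ?thesis by blast
  qed
  then have "card L \<le> card ?X + card ?Y" by (metis (no_types, lifting) card_Un_le)
  then have cards: "l + 2 \<le> card ?X + card ?Y" using card_L l by linarith
  have adj: "B x y" if "x \<in> ?X" "y \<in> ?Y" for x y
    using types_blue[of x t y "Suc t"] that L_sets by blast
  have XY: "?X \<inter> ?Y = {}" using adj B_not_T T_refl L_sets by blast
  have XC: "(?X \<union> ?Y) \<inter> (blues t \<union> blues (Suc t)) = {}" using blues_subset L_sets by blast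
  have ne: "?X \<noteq> {}" "?Y \<noteq> {}" using t by blast+
  have finXY: "finite ?X" "finite ?Y" using L_sets by auto
  have bl: "B x d" if "x \<in> {w \<in> L. typed w r}" "d \<in> blues r" for x d r
    using typed_blues W1_color blues_subset L_sets that by blast
  obtain xs where "is_cycle B xs" "length xs = 2 * l + 2"
    using two_bipartite_cycle[OF B_symp finXY adj XY bl bl XC ne cards card_blues card_blues] .
  then show False using no_B by blast
qed

end

section \<open>From a cycle of length 4 to one of length 2n\<close>

context two_colored_blowup
begin

lemma even_cycle_extend:
  assumes cyc: "is_cycle R xs" "length xs = 2 * l" and l: "2 \<le> l" "l < n"
    and no_R: "\<And>ys. is_cycle R ys \<Longrightarrow> length ys \<noteq> 2 * l + 2"
    and no_B: "\<And>ys. is_cycle B ys \<Longrightarrow> length ys \<noteq> 2 * l + 2"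
    and no_B': "\<And>ys. is_cycle B ys \<Longrightarrow> length ys \<noteq> 2 * n"
  shows False
proof -
  define ins where "ins w i \<longleftrightarrow> w \<in> V - set xs \<and> i < 2 * l \<and> R w (xs ! i) \<and> R w (xs ! (Suc i mod (2 * l)))" for w i
  \<comment> \<open>Two insertions differing in both the vertex and the edge could be carried out
    together.\<close>
  have star: "w = w' \<or> i = i'" if "ins w i" "ins w' i'" for w w' i i'
  proof (rule ccontr)
    assume ne: "\<not> ?thesis"
    have ii: "i < length xs" "i' < length xs" "i \<noteq> i'" using that ne cyc(2) by (auto simp: ins_def)
    obtain as bs where ab: "as \<noteq> []" "bs \<noteq> []" "is_cycle R (as @ bs)" "set (as @ bs) = set xs"
      "length as + length bs = length xs" "last as = xs ! i" "hd bs = xs ! (Suc i mod length xs)"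
      "last bs = xs ! i'" "hd as = xs ! (Suc i' mod length xs)"
      using is_cycle_cut_at[OF cyc(1) ii] by blast
    have "is_cycle R (as @ w # bs @ [w'])"
      by (rule is_cycle_insert_two[OF ab(3,1,2)])
        (use ab(4,6-9) that ne cyc(2) R_sym in \<open>simp_all add: ins_def\<close>)
    moreover have "length (as @ w # bs @ [w']) = 2 * l + 2" using ab(5) cyc(2) by simp
    ultimately show False using no_R by blast
  qed
  have "\<exists>p w0. is_cycle R p \<and> length p = 2 * l \<and>
    (\<forall>w j. w \<in> V - set p \<longrightarrow> w \<noteq> w0 \<longrightarrow> Suc j < 2 * l \<longrightarrow> \<not> (R w (p ! j) \<and> R w (p ! Suc j)))"
  proof (cases "\<exists>w0. \<forall>w i. ins w i \<longrightarrow> w = w0")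
    case True
    then obtain w0 where w0: "\<And>w i. ins w i \<Longrightarrow> w = w0" by blast
    have "\<not> (R w (xs ! j) \<and> R w (xs ! Suc j))"
      if "w \<in> V - set xs" "w \<noteq> w0" "Suc j < 2 * l" for w j
      using w0[of w j] that by (auto simp: ins_def)
    then show ?thesis using cyc by blast
  next
    case False
    then obtain w1 i0 w2 i2 where "ins w1 i0" "ins w2 i2" "w1 \<noteq> w2" by metis
    \<comment> \<open>By \<open>star\<close>, \<open>w1\<close> and \<open>w2\<close> use the same
      edge \<open>i0\<close>, and any \<open>w\<close> differs from one of them.\<close>
    then have i0: "i = i0" if "ins w i" for w i using star that by metis
    have "i0 < length xs" using \<open>ins w1 i0\<close> cyc(2) by (simp add: ins_def)
    then obtain p where p: "is_cycle R p" "set p = set xs" "length p = length xs" "p = rotate (Suc i0) xs"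
      using is_cycle_rotate_at[OF cyc(1)] by blast
    have nth: "p ! j = xs ! ((Suc i0 + j) mod (2 * l))" if "j < 2 * l" for j
      unfolding p(4) using nth_rotate[of j xs "Suc i0"] that cyc(2) by simp
    have "\<not> (R w (p ! j) \<and> R w (p ! Suc j))"
      if w: "w \<in> V - set p" and j: "Suc j < 2 * l" for w j
    proof
      assume R: "R w (p ! j) \<and> R w (p ! Suc j)"
      let ?i = "(Suc i0 + j) mod (2 * l)"
      have "Suc ?i mod (2 * l) = (Suc i0 + Suc j) mod (2 * l)" by (simp add: mod_Suc_eq)
      then have "ins w ?i"
        using R w j l nth[of j] nth[of "Suc j"] p(2) by (simp add: ins_def)
      then have eq: "?i = i0" using i0 by blast
      have "i0 < 2 * l" using \<open>i0 < length xs\<close> cyc(2) by simp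
      then have "?i = (if Suc i0 + j < 2 * l then Suc i0 + j else Suc i0 + j - 2 * l)"
        using j by (simp add: mod_if)
      then show False using eq j by (simp split: if_splits)
    qed
    then show ?thesis using p cyc(2) by metis
  qed
  then obtain p w0 where p: "is_cycle R p" "length p = 2 * l"
    and inner: "\<And>w j. w \<in> V - set p \<Longrightarrow> w \<noteq> w0 \<Longrightarrow> Suc j < 2 * l \<Longrightarrow> \<not> (R w (p ! j) \<and> R w (p ! Suc j))"
    by blast
  interpret even_cycle_step V T R B n p l w0
    by unfold_locales (fact p l no_R no_B no_B' inner)+
  show False by (rule contradiction)
qed

text \<open>Twins have the same red and the same blue neighbors, and two of any three neighbors
  agree in color. Without twins this is a 2-colored complete graph on at least 12 vertices, in which
  some \<open>v\<close> has six neighbors in one color.\<close>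

lemma monochromatic_C4:
  "\<exists>xs. length xs = 4 \<and> (is_cycle R xs \<or> is_cycle B xs)"
proof -
  have C4: ?thesis if "symp Q" "Q = R \<or> Q = B" "u \<noteq> v" "2 \<le> card S" "\<And>s. s \<in> S \<Longrightarrow> Q u s \<and> Q v s" for Q u v S
  proof -
    have adj: "Q x y" if "x \<in> {u, v}" "y \<in> S" for x y using that \<open>\<And>s. s \<in> S \<Longrightarrow> Q u s \<and> Q v s\<close> by blast
    have irr: "\<not> Q x x" for x
    proof
      assume "Q x x"
      then show False using R_not_T B_not_T R_dom B_dom T_refl \<open>Q = R \<or> Q = B\<close> by blast
    qed
    have "{u, v} \<inter> S = {}" using adj irr by blast
    moreover have "2 \<le> card {u, v}" using \<open>u \<noteq> v\<close> by simp
    ultimately obtain xs where "is_cycle Q xs" "length xs = 2 * 2"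
      using complete_bipartite_cycle[where X = "{u, v}", OF \<open>symp Q\<close> adj _ _ \<open>2 \<le> card S\<close>] by auto
    then show ?thesis using \<open>Q = R \<or> Q = B\<close> by auto
  qed
  have two: "2 * m \<le> card {x \<in> S. R u x} + card {x \<in> S. B u x} + 1 \<Longrightarrow>
      m \<le> card {x \<in> S. R u x} \<or> m \<le> card {x \<in> S. B u x}" for m S u
    by linarith
  have split: "card S \<le> card {x \<in> S. R u x} + card {x \<in> S. B u x}" if "S \<subseteq> V - {y. T u y}" "u \<in> V" for S u
  proof -
    have "S = {x \<in> S. R u x} \<union> {x \<in> S. B u x}" using that total[of u] by blast
    then show ?thesis by (metis card_Un_le)
  qed
  show ?thesis
  proof (cases "\<exists>u v. u \<noteq> v \<and> T u v")
    case True
    then obtain u v where uv: "u \<noteq> v" "T u v" by blast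
    let ?S = "V - {y. T u y}"
    have "u \<in> V" using uv T_dom by blast
    have "card V - card {y. T u y} \<le> card ?S" using finite_class by (intro diff_card_le_card_Diff)
    then have "3 \<le> card ?S" using class_small[OF \<open>u \<in> V\<close>] card_V n by linarith
    then have "2 \<le> card {x \<in> ?S. R u x} \<or> 2 \<le> card {x \<in> ?S. B u x}"
      using split[of ?S u] \<open>u \<in> V\<close> by (intro two) simp
    then show ?thesis
      using C4[OF R_symp _ uv(1), of "{x \<in> ?S. R u x}"] C4[OF B_symp _ uv(1), of "{x \<in> ?S. B u x}"]
        R_cong[OF uv(2)] B_cong[OF uv(2)] by blast
  next
    case False
    then have T_eq: "T u v \<longleftrightarrow> u = v \<and> u \<in> V" for u v using T_refl T_dom by blast
    have nbr: ?thesis if Q: "symp Q" "Q = R \<or> Q = B" "symp Q'" "Q' = R \<or> Q' = B"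
        and tot: "\<And>x y. x \<in> V \<Longrightarrow> y \<in> V \<Longrightarrow> x \<noteq> y \<Longrightarrow> Q x y \<or> Q' x y"
        and S: "6 \<le> card S" "\<And>s. s \<in> S \<Longrightarrow> Q v s" "S \<subseteq> V" for Q Q' v S
    proof (rule ccontr)
      assume no: "\<not> ?thesis"
      have irr: "\<not> Q x x" "\<not> Q' x x" for x
        using Q(2,4) R_not_T B_not_T R_dom B_dom T_refl by blast+
      have finS: "finite S" using S(1) card.infinite by fastforce
      obtain P where P: "P \<subseteq> S" "card P = 2" "finite P"
        using obtain_subset_with_card_n[of 2 S] S(1) by auto
      then obtain u u' where u: "u \<in> S" "u' \<in> S" "u \<noteq> u'" "P = {u, u'}" by (auto simp: card_2_iff)
      \<comment> \<open>Each of \<open>u\<close> and \<open>u'\<close> has at most one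
        \<open>Q\<close>-neighbor in \<open>D\<close>, since two would form a 4-cycle with it and
        \<open>v\<close>. So at least two vertices of \<open>D\<close> are joined to both in
        \<open>Q'\<close>.\<close>
      define D where "D = S - P"
      have "4 \<le> card D" using S(1) P finS by (simp add: D_def card_Diff_subset)
      have one: "card {x \<in> D. Q w x} \<le> 1" if "w \<in> S" for w
      proof (rule ccontr)
        assume "\<not> ?thesis"
        then have "2 \<le> card {x \<in> D. Q w x}" by simp
        moreover have "v \<noteq> w" using S(2)[OF that] irr by blast
        moreover have "Q v x \<and> Q w x" if "x \<in> {x \<in> D. Q w x}" for x
          using that S(2) by (simp add: D_def)
        ultimately show False using C4[OF Q(1,2), of v w "{x \<in> D. Q w x}"] no by blast
      qed
      have "D \<subseteq> {x \<in> D. Q u x} \<union> {x \<in> D. Q u' x} \<union> {x \<in> D. Q' u x \<and> Q' u' x}"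
        using tot[of u] tot[of u'] u S(3) unfolding D_def by blast
      then have "card D \<le> card ({x \<in> D. Q u x} \<union> {x \<in> D. Q u' x} \<union> {x \<in> D. Q' u x \<and> Q' u' x})"
        using finS by (intro card_mono) (auto simp: D_def)
      also have "\<dots> \<le> card ({x \<in> D. Q u x} \<union> {x \<in> D. Q u' x}) + card {x \<in> D. Q' u x \<and> Q' u' x}"
        by (rule card_Un_le)
      also have "card ({x \<in> D. Q u x} \<union> {x \<in> D. Q u' x}) \<le> card {x \<in> D. Q u x} + card {x \<in> D. Q u' x}"
        by (rule card_Un_le)
      finally have "2 \<le> card {x \<in> D. Q' u x \<and> Q' u' x}"
        using one[OF u(1)] one[OF u(2)] \<open>4 \<le> card D\<close> by linarith
      then show False using C4[OF Q(3,4) u(3), of "{x \<in> D. Q' u x \<and> Q' u' x}"] no by blast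
    qed
    obtain v where v: "v \<in> V" using card_V n by fastforce
    let ?S = "V - {v}"
    have "card ?S = card V - 1" using v by (simp add: card_Diff_singleton)
    then have "11 \<le> card ?S" using card_V n by linarith
    moreover have "card ?S \<le> card {x \<in> ?S. R v x} + card {x \<in> ?S. B v x}"
      using v by (intro split) (auto simp: T_eq)
    ultimately have "6 \<le> card {x \<in> ?S. R v x} \<or> 6 \<le> card {x \<in> ?S. B v x}" by (intro two) simp
    then show ?thesis
    proof
      assume "6 \<le> card {x \<in> ?S. R v x}"
      then show ?thesis using total T_eq by (intro nbr[OF R_symp _ B_symp]) auto
    next
      assume "6 \<le> card {x \<in> ?S. B v x}"
      then show ?thesis using total T_eq by (intro nbr[OF B_symp _ R_symp]) auto
    qed
  qed
qed

theorem monochromatic_cycle: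
  "\<exists>xs. length xs = 2 * n \<and> (is_cycle R xs \<or> is_cycle B xs)"
proof (rule ccontr)
  assume "\<not> ?thesis"
  then have no: "length xs \<noteq> 2 * n" if "is_cycle R xs \<or> is_cycle B xs" for xs
    using that by blast
  have "\<exists>xs. length xs = 2 * l \<and> (is_cycle R xs \<or> is_cycle B xs)" if "2 \<le> l" "l \<le> n" for l
    using that
  proof (induction l rule: dec_induct)
    case base
    then show ?case using monochromatic_C4 by fastforce
  next
    case (step l)
    then obtain xs where xs: "length xs = 2 * l" "is_cycle R xs \<or> is_cycle B xs" by auto
    have l: "2 \<le> l" "l < n" using step by auto
    show ?case
    proof (rule ccontr)
      assume "\<not> ?case"
      then have no': "length ys \<noteq> 2 * l + 2" if "is_cycle R ys \<or> is_cycle B ys" for ys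
        using that by auto
      from xs(2) show False
      proof
        assume "is_cycle R xs"
        then show False using even_cycle_extend[OF _ xs(1) l] no no' by blast
      next
        assume "is_cycle B xs"
        then show False using two_colored_blowup.even_cycle_extend[OF swap _ xs(1) l] no no' by blast
      qed
    qed
  qed
  from this[of n] show False using no n by auto
qed

end

section \<open>Gallai colorings\<close>

definition gallai_on :: "('a set \<Rightarrow> nat) \<Rightarrow> 'a set \<Rightarrow> bool" where
  "gallai_on c S \<longleftrightarrow> (\<forall>x\<in>S. \<forall>y\<in>S. \<forall>z\<in>S. x \<noteq> y \<longrightarrow> y \<noteq> z \<longrightarrow> x \<noteq> z \<longrightarrow>
     c {x, y} = c {y, z} \<or> c {y, z} = c {x, z} \<or> c {x, y} = c {x, z})"

text \<open>On \<open>S\<close>, the classes of the reflexive transitive closure are the components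
  of the colors \<open>I\<close>; outside \<open>S\<close> the closure is the identity.\<close>

definition color_edges :: "('a set \<Rightarrow> nat) \<Rightarrow> nat set \<Rightarrow> 'a set \<Rightarrow> ('a \<times> 'a) set" where
  "color_edges c I S = {(x, y). x \<in> S \<and> y \<in> S \<and> x \<noteq> y \<and> c {x, y} \<in> I}"

definition color_connected :: "('a set \<Rightarrow> nat) \<Rightarrow> nat set \<Rightarrow> 'a set \<Rightarrow> bool" where
  "color_connected c I S \<longleftrightarrow> (\<forall>x\<in>S. \<forall>y\<in>S. (x, y) \<in> (color_edges c I S)\<^sup>*)"

lemma gallai_on_subset: "gallai_on c S \<Longrightarrow> S' \<subseteq> S \<Longrightarrow> gallai_on c S'"
  unfolding gallai_on_def by blast

lemma color_edges_mono: "I \<subseteq> J \<Longrightarrow> S \<subseteq> S' \<Longrightarrow> color_edges c I S \<subseteq> color_edges c J S'"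
  by (auto simp: color_edges_def)

lemma color_reach_sym: "(x, y) \<in> (color_edges c I S)\<^sup>* \<Longrightarrow> (y, x) \<in> (color_edges c I S)\<^sup>*"
proof -
  have "sym (color_edges c I S)" by (auto simp: color_edges_def sym_def insert_commute)
  then show "(x, y) \<in> (color_edges c I S)\<^sup>* \<Longrightarrow> (y, x) \<in> (color_edges c I S)\<^sup>*"
    by (meson sym_rtrancl symD)
qed

text \<open>For an edge \<open>u w\<close> with color in \<open>I\<close> in the component of
  \<open>x\<close>, both \<open>u y\<close> and \<open>w y\<close> have colors outside
  \<open>I\<close>. They agree, as the triangle is not rainbow.\<close>

lemma color_component_const:
  assumes g: "gallai_on c S" and "(x, x') \<in> (color_edges c I S)\<^sup>*" and x: "x \<in> S" and y: "y \<in> S"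
    and not: "(x, y) \<notin> (color_edges c I S)\<^sup>*"
  shows "x' \<in> S \<and> c {x', y} = c {x, y}"
  using assms(2)
proof (induction rule: rtrancl_induct)
  case base
  then show ?case using x by simp
next
  case (step u w)
  have uw: "u \<in> S" "w \<in> S" "u \<noteq> w" "c {u, w} \<in> I" using step(2) by (auto simp: color_edges_def)
  have nreach: "(u, y) \<notin> (color_edges c I S)\<^sup>*" "(w, y) \<notin> (color_edges c I S)\<^sup>*"
    using not step(1,2) by (meson rtrancl_trans rtrancl.rtrancl_into_rtrancl)+
  then have "u \<noteq> y" "w \<noteq> y" by auto
  moreover have "c {u, y} \<notin> I" "c {w, y} \<notin> I"
    using nreach uw y calculation by (auto simp: color_edges_def)
  ultimately have "c {u, y} = c {w, y}"
    using g uw y unfolding gallai_on_def by metis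
  then show ?case using step.IH uw by simp
qed

lemma color_components_const:
  assumes g: "gallai_on c S" and "(x, x') \<in> (color_edges c I S)\<^sup>*" "(y, y') \<in> (color_edges c I S)\<^sup>*"
    and "x \<in> S" "y \<in> S" and not: "(x, y) \<notin> (color_edges c I S)\<^sup>*"
  shows "c {x', y'} = c {x, y}"
proof -
  have 1: "x' \<in> S \<and> c {x', y} = c {x, y}" by (rule color_component_const[OF g]) (use assms in auto)
  have "(y, x') \<notin> (color_edges c I S)\<^sup>*"
    using not assms(2) color_reach_sym by (meson rtrancl_trans)
  then have "c {y', x'} = c {y, x'}"
    using color_component_const[OF g assms(3) assms(5)] 1 by blast
  then show ?thesis using 1 by (simp add: insert_commute)
qed

text \<open>Remove a vertex \<open>v\<close>. If a color \<open>i\<close> becomes disconnected, then \<open>v\<close> has an \<open>i\<close>-neighbor in each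
  \<open>i\<close>-component, so an edge of another color \<open>e\<close> from \<open>v\<close> to \<open>z\<close> forces the color \<open>e\<close> between the
  component of \<open>z\<close> and every other component.\<close>

lemma gallai_at_most_two_connected:
  assumes "finite S" "gallai_on c S" "2 \<le> card S" "3 \<le> card K" "\<And>i. i \<in> K \<Longrightarrow> color_connected c {i} S"
  shows False
  using assms
proof (induction S rule: finite_induct)
  case empty
  then show ?case by simp
next
  case (insert v S)
  have edge: "\<exists>z\<in>S. c {v, z} = i" if "i \<in> K" for i
  proof -
    obtain u where "u \<in> S" using insert.prems(2) insert.hyps by fastforce
    then have "(v, u) \<in> (color_edges c {i} (insert v S))\<^sup>*" "v \<noteq> u"
      using insert.prems(4)[OF that] insert.hyps by (auto simp: color_connected_def)
    then obtain z where "(v, z) \<in> color_edges c {i} (insert v S)" by (meson converse_rtranclE)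
    then show ?thesis by (auto simp: color_edges_def)
  qed
  have finK: "finite K" using insert.prems(3) card.infinite by fastforce
  have two: "\<exists>e\<in>K - {i}. \<exists>f\<in>K - {i}. e \<noteq> f" for i
  proof -
    have "2 \<le> card (K - {i})" using insert.prems(3) diff_card_le_card_Diff[of "{i}" K] by simp
    then obtain P where "P \<subseteq> K - {i}" "card P = 2" using obtain_subset_with_card_n by metis
    then show ?thesis by (auto simp: card_2_iff)
  qed
  show False
  proof (cases "\<forall>i\<in>K. color_connected c {i} S")
    case True
    show False
    proof (cases "2 \<le> card S")
      case card: True
      then show False
        using insert.IH insert.prems True gallai_on_subset by blast
    next
      case card: False
      obtain e f where ef: "e \<in> K" "f \<in> K" "e \<noteq> f" using two by blast
      obtain x y where "x \<in> S" "c {v, x} = e" "y \<in> S" "c {v, y} = f" using edge ef by blast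
      then have "x \<noteq> y" using ef by blast
      then have "2 \<le> card S" using card_mono[of S "{x, y}"] \<open>x \<in> S\<close> \<open>y \<in> S\<close> insert.hyps by simp
      then show False using card by simp
    qed
  next
    case False
    then obtain i where i: "i \<in> K" "\<not> color_connected c {i} S" by blast
    define r where "r = (color_edges c {i} S)\<^sup>*"
    have gS: "gallai_on c S" using insert.prems(1) by (rule gallai_on_subset) blast
    have rsym: "(y, x) \<in> r" if "(x, y) \<in> r" for x y using that color_reach_sym unfolding r_def by metis
    have rtrans: "(x, z) \<in> r" if "(x, y) \<in> r" "(y, z) \<in> r" for x y z using that unfolding r_def by simp
    \<comment> \<open>On a path of color \<open>i\<close> from \<open>z\<close> to \<open>v\<close>,
      the vertex before the first visit to \<open>v\<close> is still in the component of
      \<open>z\<close> in \<open>S\<close>.\<close>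
    have nbr: "\<exists>x\<in>S. (z, x) \<in> r \<and> c {v, x} = i" if "z \<in> S" for z
    proof -
      have "(z, v) \<in> (color_edges c {i} (insert v S))\<^sup>*"
        using insert.prems(4)[OF i(1)] that by (auto simp: color_connected_def)
      then have "z \<in> S \<longrightarrow> ?thesis"
      proof (induction rule: converse_rtrancl_induct)
        case base
        then show ?case using insert.hyps by simp
      next
        case (step z z')
        show ?case
        proof
          assume z: "z \<in> S"
          show "\<exists>x\<in>S. (z, x) \<in> r \<and> c {v, x} = i"
          proof (cases "z' = v")
            case True
            then show ?thesis using step(1) z by (auto simp: color_edges_def r_def insert_commute)
          next
            case False
            then have e: "(z, z') \<in> color_edges c {i} S" "z' \<in> S"
              using step(1) z by (auto simp: color_edges_def)
            then obtain x where "x \<in> S" "(z', x) \<in> r" "c {v, x} = i" using step.IH by blast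
            moreover from this have "(z, x) \<in> r"
              using e(1) unfolding r_def by (meson converse_rtrancl_into_rtrancl)
            ultimately show ?thesis by blast
          qed
        qed
      qed
      then show ?thesis using that by blast
    qed
    have spread: "c {z, y} = e"
      if z: "z \<in> S" "c {v, z} = e" "e \<noteq> i" and y: "y \<in> S" "(z, y) \<notin> r" for z y e
    proof -
      obtain x where x: "x \<in> S" "(y, x) \<in> r" "c {v, x} = i" using nbr[OF y(1)] by blast
      have zx: "(z, x) \<notin> r" using x y rsym rtrans by blast
      then have "z \<noteq> x" unfolding r_def by blast
      moreover have "c {z, x} \<noteq> i"
        using zx x(1) z(1) calculation by (auto simp: r_def color_edges_def)
      moreover have "v \<noteq> z" "v \<noteq> x" using insert.hyps z x by blast+
      moreover have "v \<in> insert v S" "z \<in> insert v S" "x \<in> insert v S" using x z by auto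
      ultimately have "c {z, x} = e"
        using insert.prems(1) z x unfolding gallai_on_def by metis
      moreover have "c {z, x} = c {z, y}"
        using color_components_const[OF gS, of z z "{i}" y x] x y z unfolding r_def by simp
      ultimately show ?thesis by simp
    qed
    obtain e f where ef: "e \<in> K" "f \<in> K" "e \<noteq> f" "e \<noteq> i" "f \<noteq> i" using two[of i] by blast
    obtain z where z: "z \<in> S" "c {v, z} = e" using edge ef by blast
    obtain z' where z': "z' \<in> S" "c {v, z'} = f" using edge ef by blast
    \<comment> \<open>If \<open>z\<close> and \<open>z'\<close> share a component, a vertex
      \<open>y\<close> of another one has the same color to both, yet \<open>spread\<close> gives
      \<open>e\<close> and \<open>f\<close>. If not, the edge \<open>z z'\<close> itself gets both
      colors.\<close>
    show False
    proof (cases "(z, z') \<in> r")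
      case True
      obtain y where y: "y \<in> S" "(z, y) \<notin> r"
        using i(2) z(1) rsym rtrans unfolding color_connected_def r_def[symmetric] by blast
      then have "(z', y) \<notin> r" using True rtrans by blast
      then have "c {z', y} = f" "c {z, y} = e" using spread z z' ef y by blast+
      moreover have "c {z', y} = c {z, y}"
        using color_component_const[OF gS] True y z unfolding r_def by blast
      ultimately show False using ef by simp
    next
      case False
      then have "(z', z) \<notin> r" using rsym by blast
      then have "c {z, z'} = e" "c {z', z} = f" using spread z z' ef False by blast+
      then show False using ef by (simp add: insert_commute)
    qed
  qed
qed

text \<open>Gallai's theorem. For a minimal \<open>J\<close>, every color of \<open>J\<close> connects the quotient of \<open>A\<close> by the
  components of the remaining colors.\<close>

lemma gallai_two_colors_disconnect:
  assumes fin: "finite A" and g: "gallai_on c A" and card: "2 \<le> card A"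
  obtains J where "J \<subseteq> {..<k}" "card J \<le> 2" "\<not> color_connected c ({..<k} - J) A"
proof -
  define P where "P J \<longleftrightarrow> J \<subseteq> {..<k} \<and> \<not> color_connected c ({..<k} - J) A" for J
  have "\<not> color_connected c {} A"
  proof -
    obtain B where "B \<subseteq> A" "card B = 2" using obtain_subset_with_card_n[OF card] by blast
    then obtain x y where "x \<in> A" "y \<in> A" "x \<noteq> y" by (auto simp: card_2_iff)
    then show ?thesis by (auto simp: color_connected_def color_edges_def)
  qed
  then have "P {..<k}" by (simp add: P_def)
  then obtain J where J: "P J" and min: "\<And>J'. P J' \<Longrightarrow> card J \<le> card J'"
    using ex_has_least_nat[of P _ card] by blast
  have "card J \<le> 2"
  proof (rule ccontr)
    assume "\<not> card J \<le> 2"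
    define I where "I = {..<k} - J"
    define r where "r = (color_edges c I A)\<^sup>*"
    have rrefl: "(x, x) \<in> r" for x by (simp add: r_def)
    have rsym: "(y, x) \<in> r" if "(x, y) \<in> r" for x y using that color_reach_sym unfolding r_def by metis
    have rtrans: "(x, z) \<in> r" if "(x, y) \<in> r" "(y, z) \<in> r" for x y z using that unfolding r_def by simp
    define rep where "rep x = (SOME y. (x, y) \<in> r)" for x
    have rep: "(x, rep x) \<in> r" for x unfolding rep_def by (rule someI) (rule rrefl)
    have rep_eq: "rep x = rep y" if "(x, y) \<in> r" for x y
    proof -
      have "(x, z) \<in> r \<longleftrightarrow> (y, z) \<in> r" for z using that rsym rtrans by blast
      then show ?thesis by (simp add: rep_def)
    qed
    have rep_A: "rep x \<in> A" if "x \<in> A" for x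
      using rep[of x] that unfolding r_def by (induction rule: rtrancl_induct) (auto simp: color_edges_def)
    \<comment> \<open>By minimality of \<open>J\<close>, the colors of \<open>I\<close> and
      \<open>j\<close> together connect \<open>A\<close>. Contracting the components of
      \<open>I\<close> turns a path in these colors into a path of color \<open>j\<close> between
      representatives.\<close>
    have conn: "color_connected c {j} (rep ` A)" if j: "j \<in> J" for j
    proof -
      have "finite J" using J finite_subset unfolding P_def by blast
      then have "\<not> P (J - {j})" using min[of "J - {j}"] card_Diff1_less[OF _ j] by fastforce
      moreover have "{..<k} - (J - {j}) = insert j I" using J j by (auto simp: I_def P_def)
      ultimately have "color_connected c (insert j I) A" using J by (auto simp: P_def)
      moreover have "(rep x, rep y) \<in> (color_edges c {j} (rep ` A))\<^sup>*"
        if "(x, y) \<in> (color_edges c (insert j I) A)\<^sup>*" for x y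
        using that
      proof (induction rule: rtrancl_induct)
        case (step y z)
        have yz: "y \<in> A" "z \<in> A" "y \<noteq> z" "c {y, z} \<in> insert j I"
          using step(2) by (auto simp: color_edges_def)
        show ?case
        proof (cases "(y, z) \<in> r")
          case True
          then show ?thesis using rep_eq step.IH by metis
        next
          case False
          then have "c {y, z} \<notin> I" using yz by (auto simp: r_def color_edges_def)
          then have "c {y, z} = j" using yz by blast
          then have "c {rep y, rep z} = j"
            using color_components_const[OF g, of y "rep y" I z "rep z"] rep False yz
            unfolding r_def by metis
          moreover have "rep y \<noteq> rep z" using False rep rsym rtrans by metis
          ultimately have "(rep y, rep z) \<in> color_edges c {j} (rep ` A)"
            using yz by (simp add: color_edges_def)
          then show ?thesis using step.IH by (meson rtrancl.rtrancl_into_rtrancl)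
        qed
      qed simp
      ultimately show ?thesis by (auto simp: color_connected_def)
    qed
    obtain x y where xy: "x \<in> A" "y \<in> A" "(x, y) \<notin> r"
      using J unfolding P_def color_connected_def r_def I_def by blast
    then have "rep x \<noteq> rep y" using rep rsym rtrans by metis
    then have "card {rep x, rep y} = 2" by simp
    moreover have "card {rep x, rep y} \<le> card (rep ` A)" using xy fin by (intro card_mono) auto
    ultimately have "2 \<le> card (rep ` A)" by simp
    moreover have "gallai_on c (rep ` A)" using g rep_A by (intro gallai_on_subset[OF g]) auto
    moreover have "3 \<le> card J" using \<open>\<not> card J \<le> 2\<close> by simp
    ultimately show False
      using gallai_at_most_two_connected[of "rep ` A" c J] conn fin by blast
  qed
  then show ?thesis using that J unfolding P_def by blast
qed

section \<open>Reduction to a blow-up of a 2-colored complete graph\<close>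

definition mono_adj :: "('a set \<Rightarrow> nat) \<Rightarrow> nat \<Rightarrow> 'a set \<Rightarrow> 'a \<Rightarrow> 'a \<Rightarrow> bool" where
  "mono_adj c i U x y \<longleftrightarrow> x \<in> U \<and> y \<in> U \<and> x \<noteq> y \<and> c {x, y} = i"

lemma symp_mono_adj: "symp (mono_adj c i U)"
  by (auto simp: symp_def mono_adj_def insert_commute)

theorem gallai_even_cycle:
  assumes fin: "finite U" and g: "gallai_on c U" and n: "3 \<le> n" and k: "2 \<le> k"
    and col: "\<And>x y. x \<in> U \<Longrightarrow> y \<in> U \<Longrightarrow> x \<noteq> y \<Longrightarrow> c {x, y} < k"
    and card_U: "(n - 1) * k + 2 * n + 2 \<le> card U"
  shows "\<exists>i<k. \<exists>xs. is_cycle (mono_adj c i U) xs \<and> length xs = 2 * n"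
proof (rule ccontr)
  assume no: "\<not> ?thesis"
  define hom where "hom A \<longleftrightarrow> A \<subseteq> U \<and> n \<le> card A \<and> (\<forall>v\<in>U - A. \<exists>i. \<forall>a\<in>A. c {v, a} = i)" for A
  have "hom U" using card_U by (auto simp: hom_def)
  then obtain A where A: "hom A" and min: "\<And>A'. hom A' \<Longrightarrow> card A \<le> card A'"
    using ex_has_least_nat[of hom _ card] by blast
  have AU: "A \<subseteq> U" "n \<le> card A" "finite A" using A fin finite_subset by (auto simp: hom_def)
  obtain J where J: "J \<subseteq> {..<k}" "card J \<le> 2" "\<not> color_connected c ({..<k} - J) A"
    using gallai_two_colors_disconnect[OF AU(3) gallai_on_subset[OF g AU(1)]] AU n by auto
  \<comment> \<open>\<open>J\<close> may have fewer than two elements. It is enlarged to two colors;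
    removing more colors cannot reconnect \<open>A\<close>.\<close>
  obtain r b where rb: "r < k" "b < k" "r \<noteq> b" "J \<subseteq> {r, b}"
  proof -
    obtain J' where J': "J \<subseteq> J'" "J' \<subseteq> {..<k}" "card J' = 2"
      using exists_subset_between[of J 2 "{..<k}"] J k by auto
    then obtain r b where "J' = {r, b}" "r \<noteq> b" by (auto simp: card_2_iff)
    then show ?thesis using J' by (intro that[of r b]) auto
  qed
  define I where "I = {..<k} - {r, b}"
  have "I \<subseteq> {..<k} - J" using rb by (auto simp: I_def)
  then have "(color_edges c I A)\<^sup>* \<subseteq> (color_edges c ({..<k} - J) A)\<^sup>*"
    by (intro rtrancl_mono color_edges_mono) auto
  then have disconn: "\<not> color_connected c I A" using J(3) unfolding color_connected_def by blast
  define out where "out i = {v \<in> U - A. \<forall>a\<in>A. c {v, a} = i}" for i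
  have out_fin: "finite (out i)" for i using fin by (simp add: out_def)
  have out_small: "card (out i) < n" if "i < k" for i
  proof (rule ccontr)
    assume "\<not> card (out i) < n"
    then have "n \<le> card (out i)" by simp
    have adj: "mono_adj c i U x y" if "x \<in> out i" "y \<in> A" for x y
      using that AU by (auto simp: out_def mono_adj_def)
    have "out i \<inter> A = {}" "0 < n" using n by (auto simp: out_def)
    then obtain xs where "is_cycle (mono_adj c i U) xs" "length xs = 2 * n"
      using complete_bipartite_cycle[OF symp_mono_adj adj _ \<open>n \<le> card (out i)\<close> AU(2)] by blast
    then show False using no that by blast
  qed
  obtain a0 where a0: "a0 \<in> A" using AU n by fastforce
  define V where "V = A \<union> out r \<union> out b"
  have VU: "V \<subseteq> U" using AU by (auto simp: V_def out_def)
  have finV: "finite V" using VU fin finite_subset by blast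
  have gV: "gallai_on c V" using g VU by (rule gallai_on_subset)
  have "U \<subseteq> V \<union> (\<Union>i\<in>I. out i)"
  proof
    fix v assume v: "v \<in> U"
    show "v \<in> V \<union> (\<Union>i\<in>I. out i)"
    proof (cases "v \<in> A")
      case False
      then have "v \<in> U - A" using v by blast
      then obtain i where i: "\<forall>a\<in>A. c {v, a} = i" using A unfolding hom_def by blast
      then have "i < k" using col[of v a0] v a0 AU False by auto
      then show ?thesis using i v False by (auto simp: V_def I_def out_def)
    qed (simp add: V_def)
  qed
  then have "card U \<le> card (V \<union> (\<Union>i\<in>I. out i))"
    using finV out_fin by (intro card_mono) (auto simp: I_def)
  also have "\<dots> \<le> card V + card (\<Union>i\<in>I. out i)" by (rule card_Un_le)
  also have "card (\<Union>i\<in>I. out i) \<le> (\<Sum>i\<in>I. card (out i))" by (rule card_UN_le) (simp add: I_def)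
  also have "(\<Sum>i\<in>I. card (out i)) \<le> card I * (n - 1)"
    using sum_bounded_above[of I "\<lambda>i. card (out i)" "n - 1"] out_small by (fastforce simp: I_def)
  also have "card I = k - 2" using rb by (simp add: I_def card_Diff_subset)
  finally have "card U \<le> card V + (k - 2) * (n - 1)" by simp
  \<comment> \<open>The bound on \<open>card U\<close> is made for this: at most
    \<open>n - 1\<close> vertices are lost for each of \<open>k - 2\<close> colors, and at least
    \<open>4 * n\<close> remain.\<close>
  moreover have "(n - 1) * k + 2 * n + 2 = 4 * n + (k - 2) * (n - 1)"
  proof -
    obtain k' n' where "k = k' + 2" "n = n' + 1" using k n by (metis add.commute le_Suc_ex one_le_numeral order_trans)
    then show ?thesis by (simp add: algebra_simps)
  qed
  ultimately have card_V: "4 * n \<le> card V" using card_U by linarith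
  define reach where "reach = (color_edges c I V)\<^sup>*"
  define T where "T x y \<longleftrightarrow> x \<in> V \<and> y \<in> V \<and> (x, y) \<in> reach" for x y
  define R where "R i x y \<longleftrightarrow> x \<in> V \<and> y \<in> V \<and> \<not> T x y \<and> c {x, y} = i" for i x y
  have T_sym: "T y x" if "T x y" for x y
    using that color_reach_sym[of x y c I V] unfolding T_def reach_def by blast
  have T_trans: "T x z" if "T x y" "T y z" for x y z
    using that unfolding T_def reach_def by (meson rtrancl_trans)
  have T_refl: "T x x" if "x \<in> V" for x using that unfolding T_def reach_def by simp
  have R_cong: "R i x' y" if "T x x'" "R i x y" for i x x' y
  proof -
    have "\<not> T x' y" using that T_trans unfolding R_def by blast
    moreover have "c {x', y} = c {x, y}"
      using color_component_const[OF gV, of x x' I y] that unfolding R_def T_def reach_def by blast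
    ultimately show ?thesis using that unfolding R_def T_def by simp
  qed
  \<comment> \<open>In the triangle \<open>x\<close>, \<open>y\<close>, \<open>a0\<close> two edges
    have the colors \<open>r\<close> and \<open>b\<close>, so the third repeats one of them.\<close>
  have cross: "c {x, y} \<in> {r, b}" if "x \<in> out r" "y \<in> out b" for x y
  proof -
    have "c {x, a0} = r" "c {y, a0} = b" "x \<noteq> y" "x \<noteq> a0" "y \<noteq> a0" "x \<in> U" "y \<in> U" "a0 \<in> U"
      using that a0 AU rb by (auto simp: out_def)
    then show ?thesis using g rb(3) unfolding gallai_on_def by (metis insert_iff)
  qed
  \<comment> \<open>All edges between different sets among \<open>A\<close>, \<open>out r\<close>
    and \<open>out b\<close> are colored \<open>r\<close> or \<open>b\<close>, so a component of the
    other colors stays inside one of them.\<close>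
  have block: "(x \<in> A \<longrightarrow> y \<in> A) \<and> (x \<in> out r \<longrightarrow> y \<in> out r) \<and> (x \<in> out b \<longrightarrow> y \<in> out b)"
    if "(x, y) \<in> color_edges c I V" for x y
  proof -
    have xy: "x \<in> V" "y \<in> V" "c {x, y} \<noteq> r" "c {x, y} \<noteq> b" "c {y, x} \<noteq> r" "c {y, x} \<noteq> b"
      using that by (auto simp: color_edges_def I_def insert_commute)
    have "\<not> (x \<in> A \<and> y \<in> out r)" "\<not> (x \<in> A \<and> y \<in> out b)" "\<not> (y \<in> A \<and> x \<in> out r)" "\<not> (y \<in> A \<and> x \<in> out b)"
      using xy unfolding out_def by blast+
    moreover have "\<not> (x \<in> out r \<and> y \<in> out b)" "\<not> (y \<in> out r \<and> x \<in> out b)"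
      using xy cross by blast+
    ultimately show ?thesis using xy(1,2) unfolding V_def by blast
  qed
  have block': "(x \<in> A \<longrightarrow> y \<in> A \<and> (x, y) \<in> (color_edges c I A)\<^sup>*) \<and> (x \<in> out r \<longrightarrow> y \<in> out r) \<and> (x \<in> out b \<longrightarrow> y \<in> out b)"
    if "(x, y) \<in> reach" for x y
    using that unfolding reach_def
  proof (induction rule: rtrancl_induct)
    case (step y z)
    have "(y, z) \<in> color_edges c I A" if "y \<in> A"
      using step(2) block[OF step(2)] that by (auto simp: color_edges_def)
    then show ?case using step.IH block[OF step(2)] by (meson rtrancl.rtrancl_into_rtrancl)
  qed simp
  have class_small: "card {y. T x y} < n" if x: "x \<in> V" for x
  proof -
    consider "x \<in> A" | i where "i \<in> {r, b}" "x \<in> out i" using x unfolding V_def by blast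
    then show ?thesis
    proof cases
      case 1
      let ?D = "{y. T x y}"
      have DA: "?D \<subseteq> A" using block' 1 unfolding T_def by blast
      \<comment> \<open>\<open>?D\<close> is a proper subset since \<open>A\<close> is disconnected.
        Every vertex outside \<open>?D\<close> has a constant color to it: in \<open>A\<close> by
        \<open>color_component_const\<close>, elsewhere because \<open>A\<close> is homogeneous. By
        minimality of \<open>A\<close>, \<open>?D\<close> has fewer than \<open>n\<close>
        vertices.\<close>
      have "?D \<noteq> A"
      proof
        assume eq: "?D = A"
        have "(y, z) \<in> (color_edges c I A)\<^sup>*" if "y \<in> A" "z \<in> A" for y z
        proof -
          have "T y z" using that eq T_sym T_trans by blast
          then show ?thesis using block'[of y z] that unfolding T_def by blast
        qed
        then show False using disconn unfolding color_connected_def by blast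
      qed
      then have "card ?D < card A" using DA AU(3) by (intro psubset_card_mono) auto
      then have "\<not> hom ?D" using min[of ?D] by linarith
      moreover have "\<exists>i. \<forall>d\<in>?D. c {v, d} = i" if v: "v \<in> U - ?D" for v
      proof (cases "v \<in> A")
        case True
        then have "v \<in> V" by (simp add: V_def)
        then have "(x, v) \<notin> reach" using v x unfolding T_def by blast
        then have "c {d, v} = c {x, v}" if "T x d" for d
          using color_component_const[OF gV, of x d I v] that x \<open>v \<in> V\<close> unfolding T_def reach_def by blast
        then show ?thesis by (auto simp: insert_commute)
      next
        case False
        then show ?thesis using A v DA unfolding hom_def by blast
      qed
      moreover have "?D \<subseteq> U" using DA AU by blast
      ultimately show ?thesis unfolding hom_def by (meson not_le)
    next
      case 2
      then have "{y. T x y} \<subseteq> out i" using block' unfolding T_def by blast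
      then have "card {y. T x y} \<le> card (out i)" using out_fin by (intro card_mono)
      then show ?thesis using out_small[of i] 2 rb by auto
    qed
  qed
  have total: "T x y \<or> R r x y \<or> R b x y" if xy: "x \<in> V" "y \<in> V" for x y
  proof (cases "T x y")
    case False
    then have "x \<noteq> y" using T_refl xy by blast
    moreover have "c {x, y} \<notin> I"
      using False xy \<open>x \<noteq> y\<close> unfolding T_def reach_def by (auto simp: color_edges_def)
    ultimately have "c {x, y} = r \<or> c {x, y} = b"
      using col[of x y] xy VU by (auto simp: I_def)
    then show ?thesis using False xy by (auto simp: R_def)
  qed simp
  have R_symp: "symp (R i)" for i
    using T_sym by (auto simp: symp_def R_def insert_commute)
  interpret two_colored_blowup V T "R r" "R b" n
  proof unfold_locales
    show "x \<in> V" if "T x y" for x y using that by (simp add: T_def)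
    show "x \<in> V" if "R r x y" for x y using that by (simp add: R_def)
    show "x \<in> V" if "R b x y" for x y using that by (simp add: R_def)
    show "\<not> T x y" if "R r x y" for x y using that by (simp add: R_def)
    show "\<not> T x y" if "R b x y" for x y using that by (simp add: R_def)
  qed (fact finV n card_V T_refl T_sym T_trans R_symp total R_cong class_small)+
  have mono: "mono_adj c i U x y" if "R i x y" for i x y
    using that VU T_refl by (auto simp: R_def mono_adj_def)
  obtain xs where "length xs = 2 * n" "is_cycle (R r) xs \<or> is_cycle (R b) xs"
    using monochromatic_cycle by blast
  then show False using no rb is_cycle_mono mono by metis
qed

section \<open>The bounds\<close>

lemma cycle_imp_mono_copy:
  assumes "is_cycle (mono_adj c i {..<N}) xs" "length xs = m" "0 < m" "i < k"
  shows "has_mono_copy (cycle_graph m) k (complete_graph N) c"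
  unfolding has_mono_copy_def
proof (intro exI conjI ballI)
  show "inj_on ((!) xs) (verts (cycle_graph m))"
    using assms(1,2) by (auto simp: is_cycle_def inj_on_def verts_def cycle_graph_def nth_eq_iff_index_eq)
  have sub: "set xs \<subseteq> {..<N}"
    by (rule is_cycle_subset[OF assms(1)]) (simp add: mono_adj_def)
  show "(!) xs ` verts (cycle_graph m) \<subseteq> verts (complete_graph N)"
    using sub assms(2) nth_mem by (fastforce simp: verts_def cycle_graph_def complete_graph_def)
  fix e assume "e \<in> edges (cycle_graph m)"
  then obtain j where j: "j < m" "e = {j, Suc j mod m}" by (auto simp: edges_def cycle_graph_def)
  have "mono_adj c i {..<N} (xs ! j) (xs ! (Suc j mod m))"
    using is_cycle_nth[OF assms(1), of j] j assms(2) by simp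
  then show "(!) xs ` e \<in> edges (complete_graph N)" "c ((!) xs ` e) = i"
    by (simp_all add: j edges_def complete_graph_def mono_adj_def)
qed (use assms in simp)

lemma gallai_ramsey_property_upper:
  assumes "1 \<le> k" "3 \<le> n"
  shows "gallai_ramsey_property k (cycle_graph (2 * n)) ((n - 1) * k + 2 * n + 2)"
  unfolding gallai_ramsey_property_def
proof (intro allI impI)
  fix c
  let ?N = "(n - 1) * k + 2 * n + 2"
  assume c: "gallai_coloring k (complete_graph ?N) c"
  have col: "c {x, y} < k" if "x \<in> {..<?N}" "y \<in> {..<?N}" "x \<noteq> y" for x y
  proof -
    have "{x, y} \<in> [{..<?N}]\<^bsup>2\<^esup>" using that by (simp only: doubleton_in_nsets_2 simp_thms)
    then show ?thesis using c unfolding gallai_coloring_def complete_graph_def edges_def by auto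
  qed
  have "\<exists>i<k. \<exists>xs. is_cycle (mono_adj c i {..<?N}) xs \<and> length xs = 2 * n"
  \<comment> \<open>The reduction needs two distinct colors; with a single color the cycle is
    immediate.\<close>
  proof (cases "k = 1")
    case True
    have adj: "mono_adj c 0 {..<?N} x y" if "x \<in> {..<n}" "y \<in> {n..<2 * n}" for x y
      using that col[of x y] True by (auto simp: mono_adj_def)
    have "{..<n} \<inter> {n..<2 * n} = {}" "n \<le> card {..<n}" "n \<le> card {n..<2 * n}" "0 < n"
      using assms(2) by auto
    then obtain xs where "is_cycle (mono_adj c 0 {..<?N}) xs" "length xs = 2 * n"
      using complete_bipartite_cycle[OF symp_mono_adj adj] by blast
    then show ?thesis using True by blast
  next
    case False
    have "gallai_on c {..<?N}"
      using c unfolding gallai_on_def gallai_coloring_def rainbow_triangle_def complete_graph_def edges_def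
      by (simp only: snd_conv doubleton_in_nsets_2) blast
    then show ?thesis
      using gallai_even_cycle[of "{..<?N}" c n k] assms False col by simp
  qed
  then show "has_mono_copy (cycle_graph (2 * n)) k (complete_graph ?N) c"
    using cycle_imp_mono_copy assms by (metis mult_pos_pos not_numeral_le_zero not_gr_zero zero_less_numeral)
qed

lemma gallai_ramsey_property_lower:
  assumes "1 \<le> k" "3 \<le> n" "gallai_ramsey_property k (cycle_graph (2 * n)) N"
  shows "(n - 1) * k + n + 1 \<le> N"
proof (rule ccontr)
  assume "\<not> ?thesis"
  then have N: "N \<le> (n - 1) * k + n" by simp
  \<comment> \<open>Blocks \<open>0\<close> to \<open>k - 1\<close> hold
    \<open>2 * n - 1 + (k - 1) * (n - 1) = (n - 1) * k + n\<close> vertices, so \<open>k\<close>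
    colors suffice below \<open>N\<close>.\<close>
  define block where "block v = (if v < 2 * n - 1 then 0 else Suc ((v - (2 * n - 1)) div (n - 1)))" for v
  define c where "c e = block (Max e)" for e
  have block_less: "block v < k" if "v < N" for v
  proof (cases "v < 2 * n - 1")
    case True
    then show ?thesis using assms(1) by (simp add: block_def)
  next
    case False
    obtain k' where k': "k = Suc k'" using assms(1) by (cases k) auto
    have "v - (2 * n - 1) < k' * (n - 1)"
      using False that N k' by (simp add: algebra_simps)
    then have "(v - (2 * n - 1)) div (n - 1) < k'" by (rule less_mult_imp_div_less)
    then show ?thesis using False k' by (simp add: block_def)
  qed
  have c_pair: "c {x, y} = block (max x y)" for x y by (simp add: c_def)
  have gal: "gallai_coloring k (complete_graph N) c"
    unfolding gallai_coloring_def
  proof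
    show "c \<in> edges (complete_graph N) \<rightarrow> {..<k}"
    proof
      fix e assume "e \<in> edges (complete_graph N)"
      then obtain x y where "e = {x, y}" "x < N" "y < N"
        by (auto simp: edges_def complete_graph_def nsets_2_eq)
      then show "c e \<in> {..<k}" using block_less by (simp add: c_pair max_def)
    qed
    \<comment> \<open>In any triangle, the two edges at the largest vertex have the same
      color.\<close>
    show "\<not> (\<exists>x y z. rainbow_triangle (complete_graph N) c x y z)"
      by (auto simp: rainbow_triangle_def c_pair max_def split: if_splits)
  qed
  obtain f i where i: "i < k" and inj: "inj_on f {..<2 * n}"
    and f: "\<And>j. j < 2 * n \<Longrightarrow> c {f j, f (Suc j mod (2 * n))} = i"
  proof -
    have "has_mono_copy (cycle_graph (2 * n)) k (complete_graph N) c"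
      using assms(3) gal unfolding gallai_ramsey_property_def by blast
    then obtain f i where fi: "i < k \<and> inj_on f (verts (cycle_graph (2 * n))) \<and>
        f ` verts (cycle_graph (2 * n)) \<subseteq> verts (complete_graph N) \<and>
        (\<forall>e\<in>edges (cycle_graph (2 * n)). f ` e \<in> edges (complete_graph N) \<and> c (f ` e) = i)"
      unfolding has_mono_copy_def by (elim exE) (rule that)
    have "c {f j, f (Suc j mod (2 * n))} = i" if "j < 2 * n" for j
    proof -
      have "{j, Suc j mod (2 * n)} \<in> edges (cycle_graph (2 * n))"
        using that by (auto simp: edges_def cycle_graph_def)
      then have "c (f ` {j, Suc j mod (2 * n)}) = i" using fi by blast
      then show ?thesis by simp
    qed
    moreover have "inj_on f {..<2 * n}" using fi by (simp add: verts_def cycle_graph_def)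
    ultimately show ?thesis using that fi by blast
  qed
  show False
  proof (cases "i = 0")
    case True
    \<comment> \<open>Every vertex of the cycle is on an edge of color 0, so all
      \<open>2 * n\<close> of them would lie in block 0.\<close>
    have "f ` {..<2 * n} \<subseteq> {..<2 * n - 1}"
      using f True by (fastforce simp: c_pair block_def split: if_splits)
    then have "card {..<2 * n} \<le> card {..<2 * n - 1}" using inj by (intro card_inj_on_le) auto
    then show False using assms(2) by simp
  next
    case False
    define D where "D = {v. block v = i}"
    have D: "D \<subseteq> {2 * n - 1 + (i - 1) * (n - 1)..<2 * n - 1 + (i - 1) * (n - 1) + (n - 1)}"
    proof
      fix v assume "v \<in> D"
      then have v: "\<not> v < 2 * n - 1" "(v - (2 * n - 1)) div (n - 1) = i - 1"
        using False by (auto simp: D_def block_def split: if_splits)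
      have "(i - 1) * (n - 1) \<le> v - (2 * n - 1)"
        using v(2) div_times_less_eq_dividend by metis
      moreover have "v - (2 * n - 1) < (i - 1) * (n - 1) + (n - 1)"
        using dividend_less_div_times[of "n - 1" "v - (2 * n - 1)"] assms(2) unfolding v(2) by linarith
      ultimately show "v \<in> {2 * n - 1 + (i - 1) * (n - 1)..<2 * n - 1 + (i - 1) * (n - 1) + (n - 1)}"
        using v(1) unfolding atLeastLessThan_iff by linarith
    qed
    \<comment> \<open>The \<open>n\<close> disjoint edges at positions \<open>2 * j\<close>,
      \<open>2 * j + 1\<close> have distinct larger ends, all in block \<open>i\<close>, which has
      only \<open>n - 1\<close> vertices.\<close>
    define g where "g j = max (f (2 * j)) (f (2 * j + 1))" for j
    have "g ` {..<n} \<subseteq> D"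
    proof (rule image_subsetI)
      fix j assume "j \<in> {..<n}"
      then show "g j \<in> D" using f[of "2 * j"] by (simp add: c_pair g_def D_def)
    qed
    moreover have "inj_on g {..<n}"
    proof (rule inj_onI)
      fix a b assume ab: "a \<in> {..<n}" "b \<in> {..<n}" "g a = g b"
      have pick: "\<exists>a'\<in>{2 * a, 2 * a + 1}. g a = f a'" for a
        by (auto simp: g_def max_def)
      obtain a' b' where *: "a' \<in> {2 * a, 2 * a + 1}" "g a = f a'" "b' \<in> {2 * b, 2 * b + 1}" "g b = f b'"
        using pick by blast
      have "f a' = f b'" using ab(3) *(2,4) by simp
      moreover have "a' < 2 * n" "b' < 2 * n" using ab(1,2) *(1,3) by auto
      ultimately have "a' = b'" using inj_onD[OF inj] by simp
      then show "a = b" using *(1,3) unfolding insert_iff empty_iff by presburger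
    qed
    ultimately have "card {..<n} \<le> card D" using D by (intro card_inj_on_le) (auto intro: finite_subset)
    also have "\<dots> \<le> n - 1" using card_mono[OF _ D] by simp
    finally show False using assms(2) by simp
  qed
qed

theorem theorem1p9:
  fixes k n :: nat
  assumes "k \<ge> 1" and "n \<ge> 3"
  shows "(n - 1) * k + n + 1 \<le> gallai_ramsey k (cycle_graph (2 * n)) \<and>
         gallai_ramsey k (cycle_graph (2 * n)) \<le> (n - 1) * k + 2 * n + 2"
proof
  let ?P = "\<lambda>N. N > 0 \<and> gallai_ramsey_property k (cycle_graph (2 * n)) N"
  have P: "?P ((n - 1) * k + 2 * n + 2)"
    using gallai_ramsey_property_upper[OF assms] by simp
  then have "?P (gallai_ramsey k (cycle_graph (2 * n)))"
    unfolding gallai_ramsey_def by (rule LeastI)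
  then show "(n - 1) * k + n + 1 \<le> gallai_ramsey k (cycle_graph (2 * n))"
    using gallai_ramsey_property_lower[OF assms] by blast
  show "gallai_ramsey k (cycle_graph (2 * n)) \<le> (n - 1) * k + 2 * n + 2"
    unfolding gallai_ramsey_def by (rule Least_le) (rule P)
qed

end
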